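(* Let $f$ be a measurable, real-valued function defined in a neighbourhood of infinity and let $\boldsymbol{g}=(g_1,\ldots,g_n)'$ be a measurable rate vector of length $n$. Let $T$ be the set of all $x\in(0,\infty)$ for which there exists a row vector $\boldsymbol{h}(x)=(h_1(x),\ldots,h_n(x))\in\mathbb{R}^{1\times n}$ such that $$f(tx)=f(t)+\boldsymbol{h}(x)\boldsymbol{g}(t)+o(g_n(t)),\qquad t\to\infty$$ (for $x\in T$ the vector $\boldsymbol{h}(x)$ is then unique). Assume that there exists $\boldsymbol{x}=(x_1,\ldots,x_n)\in T^n$ such that (i) the $n\times n$ matrix $\boldsymbol{h}(\boldsymbol{x})$ whose $i$-th row is $\boldsymbol{h}(x_i)$ is invertible; (ii) the set $T(\boldsymbol{x})=\{y\in T: x_iy\in T\text{ for all } i\in\{1,\ldots,n\}\}$ contains a set of positive Lebesgue measure and has non-empty intersections with both $(0,1)$ and $(1,\infty)$. Then $\boldsymbol{g}\in R_{\boldsymbol{B}}$ for some index matrix $\boldsymbol{B}\in\mathbb{R}^{n\times n}$, and $f\in GRV(\boldsymbol{g})$, with $$\boldsymbol{h}(x)=\boldsymbol{c}\int_1^x y^{\boldsymbol{B}}y^{-1}\,\mathrm{d}y,\qquad x\in(0,\infty),$$ for some $\boldsymbol{c}\in\mathbb{R}^{1\times n}$. In addition, all eigenvalues (including the smallest one) of the index matrix $\boldsymbol{B}$ have geometric multiplicity equal to one.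
   Context: Limit relations are as $t\to\infty$; measurability and measure are Lebesgue. A real function is defined in a neighbourhood of infinity if its domain contains some $[t_0,\infty)$; it is eventually of constant sign if it is either strictly positive for all large $t$ or strictly negative for all large $t$. A rate vector of length $n$ is a column vector $\boldsymbol{g}=(g_1,\ldots,g_n)'$ of real-valued functions defined in a neighbourhood of infinity, each eventually of constant sign, with $g_{i+1}(t)=o(g_i(t))$ for every $i\in\{1,\ldots,n-1\}$; $o(g_n(t))$ means $o(|g_n(t)|)$, componentwise for vectors. For a square matrix $\boldsymbol{B}$ and $x>0$, $x^{\boldsymbol{B}}=\exp\{(\log x)\boldsymbol{B}\}$. An index matrix is an upper triangular $\boldsymbol{B}\in\mathbb{R}^{n\times n}$ whose diagonal elements are non-increasing and all of whose eigenvalues, except possibly the smallest one, have geometric multiplicity one. A rate vector $\boldsymbol{g}$ is regularly varying with index matrix $\boldsymbol{B}$, written $\boldsymbol{g}\in R_{\boldsymbol{B}}$, if $\boldsymbol{g}$ is measurable and $\boldsymbol{g}(xt)=x^{\boldsymbol{B}}\boldsymbol{g}(t)+o(g_n(t))$ for every $x\in(0,\infty)$. For $\boldsymbol{g}\in R_{\boldsymbol{B}}$, a measurable real-valued function $f$ defined in a neighbourhood of infinity is generalised regularly varying with rate vector $\boldsymbol{g}$ and $\boldsymbol{g}$-index $\boldsymbol{c}\in\mathbb{R}^{1\times n}$, written $f\in GRV(\boldsymbol{g})$, if for every $x\in(0,\infty)$, $f(xt)=f(t)+\boldsymbol{h}(x)\boldsymbol{g}(t)+o(g_n(t))$ with $\boldsymbol{h}(x)=\boldsymbol{c}\int_1^x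 y^{\boldsymbol{B}}y^{-1}\,\mathrm{d}y$. *)

theory Defs
  imports "HOL-Analysis.Analysis" "HOL-Library.Landau_Symbols"
begin

text \<open>
  Vectors and matrices of size n are indexed by a type \<open>'n\<close> of class
  \<open>{finite, wellorder}\<close>. Such a type is order-isomorphic to \<open>{1..n}\<close> with
  \<open>n = CARD('n)\<close>, and the numeral types provide one for every \<open>n \<ge> 1\<close>.
\<close>

definition last_index :: "'n::{finite,wellorder}" where
  "last_index = Max UNIV"

text \<open>
  Componentwise multiplication makes \<open>exp\<close> and \<open>(^)\<close> the wrong notions on
  \<open>real ^ 'n ^ 'n\<close>; the series below uses the matrix product.
\<close>

definition mat_exp :: "real ^ 'n ^ 'n \<Rightarrow> real ^ 'n ^ 'n::finite" where
  "mat_exp A = (\<Sum>k. (1 / fact k) *\<^sub>R (((**) A ^^ k) (mat 1)))"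

definition mat_powr :: "real \<Rightarrow> real ^ 'n ^ 'n \<Rightarrow> real ^ 'n ^ 'n::finite" where
  "mat_powr x B = mat_exp (ln x *\<^sub>R B)"

definition is_eigenvalue :: "real ^ 'n ^ 'n::finite \<Rightarrow> real \<Rightarrow> bool" where
  "is_eigenvalue B l \<longleftrightarrow> (\<exists>v. v \<noteq> 0 \<and> B *v v = l *\<^sub>R v)"

definition geometric_multiplicity :: "real ^ 'n ^ 'n::finite \<Rightarrow> real \<Rightarrow> nat" where
  "geometric_multiplicity B l = dim {v. B *v v = l *\<^sub>R v}"

text \<open>
  A real upper triangular matrix has only real eigenvalues, so quantifying over
  real \<open>l\<close> covers all of them.
\<close>

definition index_matrix :: "real ^ 'n::{finite,wellorder} ^ 'n::{finite,wellorder} \<Rightarrow> bool" where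
  "index_matrix B \<longleftrightarrow>
     (\<forall>i j. j < i \<longrightarrow> B $ i $ j = 0) \<and>
     (\<forall>i j. i \<le> j \<longrightarrow> B $ j $ j \<le> B $ i $ i) \<and>
     (\<forall>l. is_eigenvalue B l \<and> (\<exists>m. is_eigenvalue B m \<and> m < l)
          \<longrightarrow> geometric_multiplicity B l = 1)"

text \<open>
  A function with domain \<open>D\<close> is a total function of which only the values on
  \<open>D\<close> matter.
\<close>

definition nbhd_of_infinity :: "real set \<Rightarrow> bool" where
  "nbhd_of_infinity D \<longleftrightarrow> (\<exists>t0. {t0..} \<subseteq> D)"

definition measurable_fun_on :: "real set \<Rightarrow> (real \<Rightarrow> 'b::topological_space) \<Rightarrow> bool" where
  "measurable_fun_on D f \<longleftrightarrow> D \<in> sets lebesgue \<and> f \<in> borel_measurable (lebesgue_on D)"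

definition eventually_constant_sign :: "(real \<Rightarrow> real) \<Rightarrow> bool" where
  "eventually_constant_sign u \<longleftrightarrow>
     (\<forall>\<^sub>F t in at_top. u t > 0) \<or> (\<forall>\<^sub>F t in at_top. u t < 0)"

text \<open>
  The condition \<open>i < j \<and> {i<..<j} = {}\<close> says that \<open>j\<close> is the successor of \<open>i\<close>.
\<close>

definition rate_vector :: "real set \<Rightarrow> (real \<Rightarrow> real ^ 'n::{finite,wellorder}) \<Rightarrow> bool" where
  "rate_vector E g \<longleftrightarrow>
     nbhd_of_infinity E \<and>
     (\<forall>i. eventually_constant_sign (\<lambda>t. g t $ i)) \<and>
     (\<forall>i j. i < j \<and> {i<..<j} = {} \<longrightarrow> (\<lambda>t. g t $ j) \<in> o[at_top](\<lambda>t. g t $ i))"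

definition regularly_varying ::
  "real set \<Rightarrow> (real \<Rightarrow> real ^ 'n::{finite,wellorder}) \<Rightarrow> real ^ 'n::{finite,wellorder} ^ 'n::{finite,wellorder} \<Rightarrow> bool" where
  "regularly_varying E g B \<longleftrightarrow>
     rate_vector E g \<and> index_matrix B \<and> measurable_fun_on E g \<and>
     (\<forall>x>0. \<forall>i. (\<lambda>t. (g (x * t) - mat_powr x B *v g t) $ i)
        \<in> o[at_top](\<lambda>t. g t $ last_index))"

definition has_expansion ::
  "(real \<Rightarrow> real) \<Rightarrow> (real \<Rightarrow> real ^ 'n::{finite,wellorder}) \<Rightarrow> real \<Rightarrow> real ^ 'n::{finite,wellorder} \<Rightarrow> bool" where
  "has_expansion f g x a \<longleftrightarrow>
     (\<lambda>t. f (t * x) - f t - a \<bullet> g t) \<in> o[at_top](\<lambda>t. g t $ last_index)"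

definition expansion_set ::
  "(real \<Rightarrow> real) \<Rightarrow> (real \<Rightarrow> real ^ 'n::{finite,wellorder}) \<Rightarrow> real set" where
  "expansion_set f g = {x. x > 0 \<and> (\<exists>a. has_expansion f g x a)}"

definition expansion_coeff ::
  "(real \<Rightarrow> real) \<Rightarrow> (real \<Rightarrow> real ^ 'n::{finite,wellorder}) \<Rightarrow> real \<Rightarrow> real ^ 'n::{finite,wellorder}" where
  "expansion_coeff f g x = (THE a. has_expansion f g x a)"

text \<open>The interval integral is oriented: for \<open>x < 1\<close> it is minus the integral over \<open>(x, 1)\<close>.\<close>

definition grv_index_fun ::
  "real ^ 'n ^ 'n \<Rightarrow> real ^ 'n \<Rightarrow> real \<Rightarrow> real ^ 'n::finite" where
  "grv_index_fun B c x = c v* (LBINT y=ereal 1..ereal x. (1 / y) *\<^sub>R mat_powr y B)"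

definition generalised_regularly_varying ::
  "real set \<Rightarrow> (real \<Rightarrow> real) \<Rightarrow> real set \<Rightarrow> (real \<Rightarrow> real ^ 'n::{finite,wellorder})
     \<Rightarrow> real ^ 'n::{finite,wellorder} ^ 'n::{finite,wellorder} \<Rightarrow> real ^ 'n::{finite,wellorder} \<Rightarrow> bool" where
  "generalised_regularly_varying D f E g B c \<longleftrightarrow>
     regularly_varying E g B \<and> nbhd_of_infinity D \<and> measurable_fun_on D f \<and>
     (\<forall>x>0. has_expansion f g x (grv_index_fun B c x))"

end

(*
  With F(s) = f(e^s) and G(s) = g(e^s) the expansions become additive, and comparing the expansion of
  f at x_i y in two ways gives G(t + u) = A(u) G(t) + o(G_n(t)) for all u in log T(x), where A(u) is
  upper triangular because the components of G are ordered by growth. The set of u that admit both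
  this relation and an expansion of F is a subsemigroup of the reals; by a Steinhaus argument and
  the two points on either side of 0 it is everything. Uniqueness of coefficients makes A a measurable
  homomorphism and the coefficient h of F a measurable cocycle, h(u + v) = h(v) + h(u) A(v). Integrating
  the cocycle equation over v shows that measurable cocycles are differentiable, so A(u) = exp(u B)
  and h' = c A. A right eigenvector of B orthogonal to c is orthogonal to all h(u), hence zero because
  the matrix of the h(x_i) is invertible; this bounds the geometric multiplicities by one.
*)

theory Submission
  imports Defs
begin

section \<open>Expansions along a scale of rates\<close>

text \<open>Comparing expansions of F based at t and at t + u leaves an error o(|G_n(t)| + |G_n(t +
  u)|), and the rate conditions alone do not bound G_n(t + u) by G_n(t). The scale settles this
  itself: \<open>shift_bigo\<close> derives G_i(t + u) = O(G_i(t)) from the relation with the mixed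
  error. The u that have a matrix A(u) form a semigroup but in general not a group: for n = 1 and
  G(t) = exp(-t^2) every u > 0 has the matrix 0, and no u < 0 has any. This is why points on both
  sides of 0 enter, and why sums, not differences, of a set of positive measure have to fill an
  interval. Once every u is admissible, A(-u) inverts A(u). The rows of A(u) - 1 satisfy the same
  cocycle equation as h, so a single differentiability result covers A and h.\<close>

lemma bigo_shift_real:
  fixes f g :: "real \<Rightarrow> real"
  assumes "f \<in> O[at_top](g)"
  shows "(\<lambda>t. f (t + y)) \<in> O[at_top](\<lambda>t. g (t + y))"
  by (rule landau_o.big.compose[OF assms])
    (simp add: add.commute[of _ y] filterlim_tendsto_add_at_top[OF tendsto_const] filterlim_ident)

lemma smallo_shift_real:
  fixes f g :: "real \<Rightarrow> real"
  assumes "f \<in> o[at_top](g)"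
  shows "(\<lambda>t. f (t + y)) \<in> o[at_top](\<lambda>t. g (t + y))"
  by (rule landau_o.small.compose[OF assms])
    (simp add: add.commute[of _ y] filterlim_tendsto_add_at_top[OF tendsto_const] filterlim_ident)

locale additive_rate =
  fixes G :: "real \<Rightarrow> real ^ 'n::{finite,wellorder}"
  assumes nonzero: "\<And>i. \<forall>\<^sub>F t in at_top. G t $ i \<noteq> 0"
    and decreasing: "\<And>i j. i < j \<Longrightarrow> (\<lambda>t. G t $ j) \<in> o[at_top](\<lambda>t. G t $ i)"
begin

lemma bigo_le: "i \<le> j \<Longrightarrow> (\<lambda>t. G t $ j) \<in> O[at_top](\<lambda>t. G t $ i)"
  using decreasing[of i j] by (cases "i = j") (auto intro: landau_o.small_imp_big)

lemma last_bigo: "(\<lambda>t. G t $ last_index) \<in> O[at_top](\<lambda>t. G t $ i)"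
  by (rule bigo_le) (simp add: last_index_def)

lemma smallo_last: "f \<in> o[at_top](\<lambda>t. G t $ last_index) \<Longrightarrow> f \<in> o[at_top](\<lambda>t. G t $ i)"
  by (rule landau_o.small_big_trans[OF _ last_bigo])

lemma not_smallo_self: "(\<lambda>t. G t $ i) \<notin> o[at_top](\<lambda>t. G t $ i)"
proof
  assume "(\<lambda>t. G t $ i) \<in> o[at_top](\<lambda>t. G t $ i)"
  then have "\<forall>\<^sub>F t in at_top. G t $ i = 0" by (simp add: landau_o.small_refl_iff)
  with nonzero[of i] have "\<forall>\<^sub>F t::real in at_top. False" by eventually_elim auto
  then show False by simp
qed

text \<open>Subtracting the terms in front of j removes all that dominates \<open>G t $ j\<close>;
  the later terms and the error are negligible against it. Uniqueness, measurability and
  triangularity of coefficients are read off from this limit by induction on j.\<close>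

lemma coeff_tendsto:
  assumes "(\<lambda>t. \<phi> t - a \<bullet> G t) \<in> o[at_top](\<lambda>t. G t $ last_index)"
  shows "((\<lambda>t. (\<phi> t - (\<Sum>i | i < j. a $ i * G t $ i)) / G t $ j) \<longlongrightarrow> a $ j) at_top"
proof -
  have "(\<lambda>t. (\<phi> t - a \<bullet> G t) + (\<Sum>i | j < i. a $ i * G t $ i)) \<in> o[at_top](\<lambda>t. G t $ j)"
    by (intro sum_in_smallo big_sum_in_smallo smallo_last[OF assms]) (auto simp: decreasing)
  then have "((\<lambda>t. ((\<phi> t - a \<bullet> G t) + (\<Sum>i | j < i. a $ i * G t $ i)) / G t $ j) \<longlongrightarrow> 0) at_top"
    by (rule smalloD_tendsto)
  then have *: "((\<lambda>t. ((\<phi> t - a \<bullet> G t) + (\<Sum>i | j < i. a $ i * G t $ i)) / G t $ j + a $ j) \<longlongrightarrow> 0 + a $ j) at_top"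
    by (intro tendsto_intros)
  have split: "a \<bullet> v = (\<Sum>i | i < j. a $ i * v $ i) + a $ j * v $ j + (\<Sum>i | j < i. a $ i * v $ i)" for v
  proof -
    have U: "UNIV = insert j ({i. i < j} \<union> {i. j < i})" by auto
    have "a \<bullet> v = (\<Sum>i\<in>UNIV. a $ i * v $ i)" by (simp add: inner_vec_def)
    also have "\<dots> = a $ j * v $ j + (\<Sum>i\<in>{i. i < j} \<union> {i. j < i}. a $ i * v $ i)"
      by (subst U, subst sum.insert) auto
    also have "(\<Sum>i\<in>{i. i < j} \<union> {i. j < i}. a $ i * v $ i) =
        (\<Sum>i | i < j. a $ i * v $ i) + (\<Sum>i | j < i. a $ i * v $ i)"
      by (rule sum.union_disjoint) auto
    finally show ?thesis by simp
  qed
  show ?thesis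
    using * nonzero[of j]
    by (auto elim!: Lim_transform_eventually eventually_mono simp: split field_simps)
qed

lemma coeff_unique:
  assumes "(\<lambda>t. \<phi> t - a \<bullet> G t) \<in> o[at_top](\<lambda>t. G t $ last_index)"
    and "(\<lambda>t. \<phi> t - b \<bullet> G t) \<in> o[at_top](\<lambda>t. G t $ last_index)"
  shows "a = b"
proof -
  have "a $ j = b $ j" for j
  proof (induction j rule: less_induct)
    case (less j)
    then have "(\<Sum>i | i < j. a $ i * G t $ i) = (\<Sum>i | i < j. b $ i * G t $ i)" for t
      by (intro sum.cong) auto
    with coeff_tendsto[OF assms(1), of j] coeff_tendsto[OF assms(2), of j]
    show ?case by (auto intro: tendsto_unique[OF trivial_limit_at_top_linorder])
  qed
  then show ?thesis by (simp add: vec_eq_iff)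
qed

text \<open>Each coefficient is a pointwise limit, along integer t, of quotients in which only
  earlier coefficients occur. Measurability in u for each fixed t suffices.\<close>

lemma coeff_measurable:
  assumes \<phi>: "\<And>t. (\<lambda>u. \<phi> u t) \<in> borel_measurable M"
    and a: "\<And>u. (\<lambda>t. \<phi> u t - a u \<bullet> G t) \<in> o[at_top](\<lambda>t. G t $ last_index)"
  shows "(\<lambda>u. a u $ j) \<in> borel_measurable M"
proof (induction j rule: less_induct)
  case (less j)
  show ?case
  proof (rule borel_measurable_LIMSEQ_real)
    show "(\<lambda>k. (\<phi> u (real k) - (\<Sum>i | i < j. a u $ i * G (real k) $ i)) / G (real k) $ j)
        \<longlonglongrightarrow> a u $ j" for u
      by (rule filterlim_compose[OF coeff_tendsto[OF a] filterlim_real_sequentially])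
    show "(\<lambda>u. (\<phi> u (real k) - (\<Sum>i | i < j. a u $ i * G (real k) $ i)) / G (real k) $ j)
        \<in> borel_measurable M" for k
      by (intro borel_measurable_divide borel_measurable_diff borel_measurable_sum
          borel_measurable_times borel_measurable_const \<phi>) (use less in auto)
  qed
qed

text \<open>
  The \<open>g\<^sub>i(t + y)\<close> are asymptotically multiples of distinct \<open>g\<^sub>k(t)\<close>, with \<open>k\<close> increasing in
  \<open>i\<close>; hence \<open>k \<ge> i\<close>.
\<close>

lemma shift_bigo:
  assumes "\<And>i. (\<lambda>t. G (t + y) $ i - (M *v G t) $ i)
    \<in> o[at_top](\<lambda>t. \<bar>G t $ last_index\<bar> + \<bar>G (t + y) $ last_index\<bar>)"
  shows "(\<lambda>t. G (t + y) $ i) \<in> O[at_top](\<lambda>t. G t $ i)"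
proof (induction i rule: less_induct)
  case (less i)
  let ?r = "\<lambda>t. G (t + y) $ i - (M *v G t) $ i"
  have r: "?r \<in> o[at_top](\<lambda>t. \<bar>G t $ j\<bar> + \<bar>G (t + y) $ k\<bar>)" for j k
  proof (rule landau_o.small_big_trans[OF assms])
    have "(\<lambda>t. G t $ last_index) \<in> O[at_top](\<lambda>t. \<bar>G t $ j\<bar> + \<bar>G (t + y) $ k\<bar>)"
      by (rule landau_o.big_trans[OF last_bigo[of j]]) (auto intro!: bigoI[of _ 1])
    moreover have "(\<lambda>t. G (t + y) $ last_index) \<in> O[at_top](\<lambda>t. \<bar>G t $ j\<bar> + \<bar>G (t + y) $ k\<bar>)"
      by (rule landau_o.big_trans[OF bigo_shift_real[OF last_bigo[of k]]]) (auto intro!: bigoI[of _ 1])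
    ultimately show "(\<lambda>t. \<bar>G t $ last_index\<bar> + \<bar>G (t + y) $ last_index\<bar>)
        \<in> O[at_top](\<lambda>t. \<bar>G t $ j\<bar> + \<bar>G (t + y) $ k\<bar>)"
      by (intro sum_in_bigo) simp_all
  qed
  have row: "(M *v G t) $ i = (\<Sum>j\<in>UNIV. M $ i $ j * G t $ j)" for t
    by (simp add: matrix_vector_mult_def)
  show ?case
  proof (cases "\<forall>j<i. M $ i $ j = 0")
    case True
    have "(\<lambda>t. M $ i $ j * G t $ j) \<in> O[at_top](\<lambda>t. G t $ i)" for j
      using True bigo_le[of i j] by (cases "j < i") auto
    then have "(\<lambda>t. (M *v G t) $ i) \<in> O[at_top](\<lambda>t. G t $ i)"
      unfolding row by (intro big_sum_in_bigo)
    then obtain C where C: "\<forall>\<^sub>F t in at_top. \<bar>(M *v G t) $ i\<bar> \<le> C * \<bar>G t $ i\<bar>"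
      by (auto elim: landau_o.bigE)
    \<comment> \<open>The factor 1/2 allows the part of the error in \<open>G (t + y) $ i\<close> to
      be absorbed into the left side.\<close>
    have "\<forall>\<^sub>F t in at_top. \<bar>?r t\<bar> \<le> 1/2 * (\<bar>G t $ i\<bar> + \<bar>G (t + y) $ i\<bar>)"
      using landau_o.smallD[OF r[of i i], of "1/2"] by simp
    with C have "\<forall>\<^sub>F t in at_top. norm (G (t + y) $ i) \<le> (2 * C + 1) * norm (G t $ i)"
      by eventually_elim (simp add: algebra_simps)
    then show ?thesis by (rule bigoI)
  next
    case False
    \<comment> \<open>This case is contradictory. With j < i the leading column of row i, the
      relation makes \<open>G (t + y) $ i\<close> of exact order \<open>G t $ j\<close>; but it is o
      of \<open>G (t + y) $ j\<close>, which is O of \<open>G t $ j\<close> by induction.\<close>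
    define j where "j = (LEAST j. M $ i $ j \<noteq> 0)"
    from False have ne: "\<exists>j. M $ i $ j \<noteq> 0" by auto
    have zero: "M $ i $ k = 0" if "k < j" for k
      using not_less_Least[of k "\<lambda>j. M $ i $ j \<noteq> 0"] that by (simp add: j_def)
    have Mj: "M $ i $ j \<noteq> 0" using ne unfolding j_def by (rule LeastI_ex)
    have "j < i" using False Least_le[of "\<lambda>j. M $ i $ j \<noteq> 0"] unfolding j_def by (meson order.strict_trans1)
    have p: "(\<lambda>t. G (t + y) $ j) \<in> O[at_top](\<lambda>t. G t $ j)" by (rule less.IH[OF \<open>j < i\<close>])
    have pi: "(\<lambda>t. G (t + y) $ i) \<in> o[at_top](\<lambda>t. G t $ j)"
      by (rule landau_o.small_big_trans[OF smallo_shift_real[OF decreasing[OF \<open>j < i\<close>]] p])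
    have ri: "?r \<in> o[at_top](\<lambda>t. G t $ j)"
      by (rule landau_o.small_big_trans[OF r[of j j]]) (intro sum_in_bigo; simp add: p)
    have "(\<lambda>t. M $ i $ k * G t $ k) \<in> o[at_top](\<lambda>t. G t $ j)" if "k \<noteq> j" for k
      using that zero[of k] decreasing[of j k] by (cases "k < j") auto
    then have rest: "(\<lambda>t. \<Sum>k\<in>UNIV - {j}. M $ i $ k * G t $ k) \<in> o[at_top](\<lambda>t. G t $ j)"
      by (intro big_sum_in_smallo) auto
    have "(\<lambda>t. G (t + y) $ i - ?r t - (\<Sum>k\<in>UNIV - {j}. M $ i $ k * G t $ k)) \<in> o[at_top](\<lambda>t. G t $ j)"
      by (intro sum_in_smallo pi ri rest)
    moreover have "G (t + y) $ i - ?r t - (\<Sum>k\<in>UNIV - {j}. M $ i $ k * G t $ k) = M $ i $ j * G t $ j" for t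
      unfolding row by (subst (1) sum.remove[of UNIV j]) auto
    ultimately have "(\<lambda>t. G t $ j) \<in> o[at_top](\<lambda>t. G t $ j)" using Mj by simp
    with not_smallo_self show ?thesis by blast
  qed
qed

section \<open>Shift relations for G and F: triangularity, composition, existence\<close>

definition shift_matrix :: "real \<Rightarrow> real ^ 'n::{finite,wellorder} ^ 'n::{finite,wellorder} \<Rightarrow> bool" where
  "shift_matrix y M \<longleftrightarrow> (\<forall>i. (\<lambda>t. G (t + y) $ i - M $ i \<bullet> G t) \<in> o[at_top](\<lambda>t. G t $ last_index))"

definition increment :: "(real \<Rightarrow> real) \<Rightarrow> real \<Rightarrow> real ^ 'n::{finite,wellorder} \<Rightarrow> bool" where
  "increment F y a \<longleftrightarrow> (\<lambda>t. F (t + y) - F t - a \<bullet> G t) \<in> o[at_top](\<lambda>t. G t $ last_index)"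

lemma shift_matrix_unique: "shift_matrix y M \<Longrightarrow> shift_matrix y N \<Longrightarrow> M = N"
  unfolding shift_matrix_def vec_eq_iff[of M]
  by (rule allI, rule coeff_unique[of "\<lambda>t. G (t + y) $ _"]) auto

lemma increment_unique: "increment F y a \<Longrightarrow> increment F y b \<Longrightarrow> a = b"
  unfolding increment_def by (rule coeff_unique)

lemma shift_matrix_zero: "shift_matrix 0 (mat 1)"
proof -
  have "mat 1 $ i \<bullet> v = v $ i" for i and v :: "real ^ 'n::{finite,wellorder}"
    by (simp flip: matrix_vector_mul_component)
  then show ?thesis unfolding shift_matrix_def by simp
qed

text \<open>Expansions based at t and at t + y can be compared only up to the mixed error;
  \<open>shift_bigo\<close> reduces it to an error at t alone.\<close>

lemma shift_matrixI:
  assumes "\<And>i. (\<lambda>t. G (t + y) $ i - (M *v G t) $ i)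
    \<in> o[at_top](\<lambda>t. \<bar>G t $ last_index\<bar> + \<bar>G (t + y) $ last_index\<bar>)"
  shows "shift_matrix y M"
  unfolding shift_matrix_def
proof
  fix i
  have "(\<lambda>t. \<bar>G t $ last_index\<bar> + \<bar>G (t + y) $ last_index\<bar>) \<in> O[at_top](\<lambda>t. G t $ last_index)"
    by (intro sum_in_bigo) (simp_all add: shift_bigo[OF assms])
  from landau_o.small_big_trans[OF assms[of i] this]
  show "(\<lambda>t. G (t + y) $ i - M $ i \<bullet> G t) \<in> o[at_top](\<lambda>t. G t $ last_index)"
    by (simp add: matrix_vector_mul_component)
qed

lemma shift_matrix_bigo:
  assumes "shift_matrix y M"
  shows "(\<lambda>t. G (t + y) $ i) \<in> O[at_top](\<lambda>t. G t $ i)"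
proof (rule shift_bigo)
  fix i
  show "(\<lambda>t. G (t + y) $ i - (M *v G t) $ i)
      \<in> o[at_top](\<lambda>t. \<bar>G t $ last_index\<bar> + \<bar>G (t + y) $ last_index\<bar>)"
    by (rule landau_o.small_big_trans[of _ _ "\<lambda>t. G t $ last_index"])
      (use assms in \<open>auto simp: shift_matrix_def matrix_vector_mul_component intro!: bigoI[of _ 1]\<close>)
qed

text \<open>By induction the earlier entries of the row vanish, so the entry is the limit of
  \<open>G (t + y) $ i / G t $ j\<close>. This is 0, since the numerator is O of
  \<open>G t $ i\<close>.\<close>

lemma shift_matrix_upper_triangular:
  assumes "shift_matrix y M" and "j < i"
  shows "M $ i $ j = 0"
  using \<open>j < i\<close>
proof (induction j rule: less_induct)
  case (less j)
  have "((\<lambda>t. (G (t + y) $ i - (\<Sum>k | k < j. M $ i $ k * G t $ k)) / G t $ j) \<longlongrightarrow> M $ i $ j) at_top"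
    using assms(1) by (intro coeff_tendsto) (simp add: shift_matrix_def)
  moreover have "(\<Sum>k | k < j. M $ i $ k * G t $ k) = 0" for t
    using less by (intro sum.neutral) auto
  moreover have "((\<lambda>t. G (t + y) $ i / G t $ j) \<longlongrightarrow> 0) at_top"
    by (intro smalloD_tendsto landau_o.big_small_trans[OF shift_matrix_bigo[OF assms(1)]] decreasing less)
  ultimately show ?case by (auto intro: tendsto_unique[OF trivial_limit_at_top_linorder])
qed

lemma smallo_last_shift:
  assumes "shift_matrix y M" and "f \<in> o[at_top](\<lambda>t. G t $ last_index)"
  shows "(\<lambda>t. f (t + y)) \<in> o[at_top](\<lambda>t. G t $ last_index)"
  by (rule landau_o.small_big_trans[OF smallo_shift_real[OF assms(2)] shift_matrix_bigo[OF assms(1)]])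

lemma inner_shift_smallo:
  assumes "shift_matrix y M"
  shows "(\<lambda>t. a \<bullet> G (t + y) - (a v* M) \<bullet> G t) \<in> o[at_top](\<lambda>t. G t $ last_index)"
proof -
  have "(\<lambda>t. \<Sum>i\<in>UNIV. a $ i * (G (t + y) $ i - M $ i \<bullet> G t)) \<in> o[at_top](\<lambda>t. G t $ last_index)"
    using assms by (intro big_sum_in_smallo) (auto simp: shift_matrix_def)
  moreover have "(\<Sum>i\<in>UNIV. a $ i * (G (t + y) $ i - M $ i \<bullet> G t)) = a \<bullet> G (t + y) - (a v* M) \<bullet> G t" for t
    by (simp add: dot_lmul_matrix inner_vec_def[of a] matrix_vector_mul_component right_diff_distrib sum_subtractf)
  ultimately show ?thesis by simp
qed

text \<open>Expand at t + z first, then expand \<open>G (t + z)\<close> at t. The error of the first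
  expansion is of size o(G_n(t + z)), and \<open>shift_matrix_bigo\<close> turns it into
  o(G_n(t)).\<close>

lemma shift_matrix_add:
  assumes y: "shift_matrix y M" and z: "shift_matrix z N"
  shows "shift_matrix (y + z) (M ** N)"
  unfolding shift_matrix_def
proof
  fix i
  have "(\<lambda>t. G (t + z + y) $ i - M $ i \<bullet> G (t + z)) \<in> o[at_top](\<lambda>t. G t $ last_index)"
    using y by (intro smallo_last_shift[OF z]) (simp add: shift_matrix_def)
  from sum_in_smallo(1)[OF this inner_shift_smallo[OF z, of "M $ i"]]
  have "(\<lambda>t. G (t + (y + z)) $ i - (M $ i v* N) \<bullet> G t) \<in> o[at_top](\<lambda>t. G t $ last_index)"
    by (simp add: add_ac)
  moreover have "M $ i v* N = (M ** N) $ i"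
    by (simp add: vec_eq_iff vector_matrix_mult_def matrix_matrix_mult_def mult.commute)
  ultimately show "(\<lambda>t. G (t + (y + z)) $ i - (M ** N) $ i \<bullet> G t) \<in> o[at_top](\<lambda>t. G t $ last_index)"
    by simp
qed

text \<open>The step by x is taken from t + y, so its coefficients a refer to
  \<open>G (t + y)\<close> and are moved to \<open>G t\<close> by M. This becomes the cocycle
  equation.\<close>

lemma increment_add:
  assumes x: "increment F x a" and y: "increment F y b" and M: "shift_matrix y M"
  shows "increment F (x + y) (b + a v* M)"
proof -
  have "(\<lambda>t. F (t + y + x) - F (t + y) - a \<bullet> G (t + y)) \<in> o[at_top](\<lambda>t. G t $ last_index)"
    using x by (intro smallo_last_shift[OF M]) (simp add: increment_def)
  from sum_in_smallo(1)[OF sum_in_smallo(1)[OF this inner_shift_smallo[OF M, of a]] y[unfolded increment_def]]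
  show ?thesis by (simp add: increment_def inner_add_left algebra_simps)
qed

text \<open>Going from t to t + x_k + y directly and through t + y expresses row k of
  \<open>H *v G (t + y)\<close> as (C_k - b) applied to \<open>G t\<close>; multiplying by the
  inverse K of H isolates \<open>G (t + y)\<close>. The second route has an error at t + y, whence
  the mixed error.\<close>

lemma shift_matrix_exists:
  assumes x: "\<And>i. increment F (x i) (H $ i)" and "invertible H"
    and y: "increment F y b" and xy: "\<And>i. increment F (x i + y) (C $ i)"
  shows "\<exists>M. shift_matrix y M"
proof -
  obtain K where K: "K ** H = mat 1" using \<open>invertible H\<close> unfolding invertible_def by auto
  define M where "M = K ** (\<chi> i. C $ i - b)"
  let ?o = "o[at_top](\<lambda>t. \<bar>G t $ last_index\<bar> + \<bar>G (t + y) $ last_index\<bar>)"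
  have 1: "f \<in> ?o" if "f \<in> o[at_top](\<lambda>t. G t $ last_index)" for f :: "real \<Rightarrow> real"
    by (rule landau_o.small_big_trans[OF that]) (auto intro!: bigoI[of _ 1])
  have 2: "f \<in> ?o" if "f \<in> o[at_top](\<lambda>t. G (t + y) $ last_index)" for f :: "real \<Rightarrow> real"
    by (rule landau_o.small_big_trans[OF that]) (auto intro!: bigoI[of _ 1])
  have "(\<lambda>t. (F (t + (x k + y)) - F t - C $ k \<bullet> G t) - (F (t + y) - F t - b \<bullet> G t)
      - (F (t + y + x k) - F (t + y) - H $ k \<bullet> G (t + y))) \<in> ?o" for k
    by (rule sum_in_smallo(2)[OF sum_in_smallo(2)[OF 1[OF xy[unfolded increment_def]]
            1[OF y[unfolded increment_def]]] 2[OF smallo_shift_real[OF x[unfolded increment_def]]]])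
  then have k: "(\<lambda>t. (H *v G (t + y) - (\<chi> i. C $ i - b) *v G t) $ k) \<in> ?o" for k
    by (simp add: matrix_vector_mul_component inner_diff_left algebra_simps)
  show ?thesis
  proof (rule exI, rule shift_matrixI)
    fix i
    have "(\<lambda>t. \<Sum>k\<in>UNIV. K $ i $ k * (H *v G (t + y) - (\<chi> i. C $ i - b) *v G t) $ k) \<in> ?o"
      using k by (intro big_sum_in_smallo) auto
    moreover have "(\<Sum>k\<in>UNIV. K $ i $ k * (H *v G (t + y) - (\<chi> i. C $ i - b) *v G t) $ k)
        = G (t + y) $ i - (M *v G t) $ i" for t
    proof -
      have "(\<Sum>k\<in>UNIV. K $ i $ k * (H *v G (t + y) - (\<chi> i. C $ i - b) *v G t) $ k)
          = (K *v (H *v G (t + y) - (\<chi> i. C $ i - b) *v G t)) $ i"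
        by (simp add: matrix_vector_mult_def)
      also have "\<dots> = G (t + y) $ i - (M *v G t) $ i"
        by (simp add: matrix_vector_mult_diff_distrib matrix_vector_mul_assoc K M_def)
      finally show ?thesis .
    qed
    ultimately show "(\<lambda>t. G (t + y) $ i - (M *v G t) $ i) \<in> ?o" by simp
  qed
qed

text \<open>The diagonal entries are the limits of \<open>G (t + s) $ k / G t $ k\<close>. In the
  opposite case the ratio of component j to component i would eventually not decrease in absolute
  value along t0, t0 + s, t0 + 2s, ..., although it tends to 0.\<close>

lemma shift_diagonal_mono:
  assumes M: "shift_matrix s M" and "0 < s" "i < j" and pos: "0 < M $ i $ i" "0 < M $ j $ j"
  shows "M $ j $ j \<le> M $ i $ i"
proof (rule ccontr)
  assume "\<not> M $ j $ j \<le> M $ i $ i"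
  then have gt: "M $ j $ j / M $ i $ i > 1" using pos by simp
  let ?r = "\<lambda>t. G t $ j / G t $ i"
  have diag: "((\<lambda>t. G (t + s) $ k / G t $ k) \<longlongrightarrow> M $ k $ k) at_top" for k
  proof -
    have "(\<Sum>l | l < k. M $ k $ l * G t $ l) = 0" for t
      using shift_matrix_upper_triangular[OF M] by (intro sum.neutral) auto
    then show ?thesis
      using coeff_tendsto[of "\<lambda>t. G (t + s) $ k" "M $ k" k] M by (simp add: shift_matrix_def)
  qed
  have "((\<lambda>t. (G (t + s) $ j / G t $ j) / (G (t + s) $ i / G t $ i)) \<longlongrightarrow> M $ j $ j / M $ i $ i) at_top"
    using pos by (intro tendsto_divide diag) auto
  from order_tendstoD(1)[OF this gt] nonzero[of i] nonzero[of j]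
  have "\<forall>\<^sub>F t in at_top. ?r t \<noteq> 0 \<and> ?r (t + s) / ?r t > 1"
    by eventually_elim (simp add: field_simps)
  then obtain t0 where t0: "\<And>t. t \<ge> t0 \<Longrightarrow> ?r t \<noteq> 0 \<and> ?r (t + s) / ?r t > 1"
    by (auto simp: eventually_at_top_linorder)
  have incr: "\<bar>?r t\<bar> \<le> \<bar>?r (t + s)\<bar>" if "t \<ge> t0" for t
  proof -
    have "1 < \<bar>?r (t + s) / ?r t\<bar>" by (rule less_le_trans[OF conjunct2[OF t0[OF that]] abs_ge_self])
    moreover have pos: "0 < \<bar>?r t\<bar>" using t0[OF that] by (blast intro: iffD2[OF zero_less_abs_iff])
    ultimately have "1 < \<bar>?r (t + s)\<bar> / \<bar>?r t\<bar>" by (simp only: abs_divide)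
    with pos show ?thesis by (simp only: less_divide_eq_1_pos less_imp_le)
  qed
  have lower: "\<bar>?r t0\<bar> \<le> \<bar>?r (t0 + real k * s)\<bar>" for k
  proof (induction k)
    case (Suc k)
    also have "\<bar>?r (t0 + real k * s)\<bar> \<le> \<bar>?r (t0 + real k * s + s)\<bar>"
      using \<open>0 < s\<close> by (intro incr) auto
    finally show ?case by (simp add: algebra_simps)
  qed simp
  have "(?r \<longlongrightarrow> 0) at_top" by (rule smalloD_tendsto[OF decreasing[OF \<open>i < j\<close>]])
  moreover have "filterlim (\<lambda>k. t0 + real k * s) at_top sequentially"
    using \<open>0 < s\<close> by (intro filterlim_tendsto_add_at_top[OF tendsto_const]
      filterlim_at_top_mult_tendsto_pos[OF tendsto_const] filterlim_real_sequentially)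
  ultimately have "(\<lambda>k. \<bar>?r (t0 + real k * s)\<bar>) \<longlonglongrightarrow> 0"
    using tendsto_rabs_zero filterlim_compose by blast
  then have "\<bar>?r t0\<bar> \<le> 0" by (rule LIMSEQ_le_const) (use lower in auto)
  with t0[of t0] show False by simp
qed

end

section \<open>Steinhaus theorem and subsemigroups of the reals\<close>

text \<open>Reduces measurable sets to compact ones, which have uniform neighbourhoods inside open
  supersets, are Borel, and have compact continuous images.\<close>

lemma compact_inner_non_negligible:
  fixes S :: "'a::euclidean_space set"
  assumes "S \<in> sets lebesgue" and "\<not> negligible S"
  obtains K where "compact K" "K \<subseteq> S" "\<not> negligible K"
proof -
  have "S = (\<Union>m. S \<inter> cball 0 (real m))"
    using real_arch_simple by auto
  then obtain m where m: "\<not> negligible (S \<inter> cball 0 (real m))"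
    using assms(2) negligible_countable_Union[of "range (\<lambda>m. S \<inter> cball 0 (real m))"] by fastforce
  have sets: "S \<inter> cball 0 (real m) \<in> sets lebesgue"
    using assms(1) by auto
  then have fin: "emeasure lebesgue (S \<inter> cball 0 (real m)) > 0"
    using m by (auto simp: negligible_iff_null_sets null_sets_def zero_less_iff_neq_zero)
  then obtain e :: real where e: "e > 0" "ennreal e < emeasure lebesgue (S \<inter> cball 0 (real m))"
    using dense[of 0] by (metis ennreal_cases ennreal_less_zero_iff top.extremum_strict)
  obtain K where K: "closed K" "K \<subseteq> S \<inter> cball 0 (real m)"
      "emeasure lebesgue ((S \<inter> cball 0 (real m)) - K) < ennreal e"
    using sets_lebesgue_inner_closed[OF sets e(1)] by metis
  have "\<not> negligible K"
  proof
    assume "negligible K"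
    then have "emeasure lebesgue ((S \<inter> cball 0 (real m)) - K) = emeasure lebesgue (S \<inter> cball 0 (real m))"
      by (intro emeasure_Diff_null_set sets) (simp add: negligible_iff_null_sets)
    with K e show False by simp
  qed
  moreover have "compact K"
    using K by (meson bounded_cball bounded_subset compact_eq_bounded_closed le_inf_iff)
  ultimately show ?thesis using that K by blast
qed

text \<open>Choose an open U around K such that U - K has smaller measure than K. A small translate
  of K stays inside U, and if it missed K it would fit into U - K.\<close>

lemma steinhaus_compact:
  fixes K :: "real set"
  assumes "compact K" and "\<not> negligible K"
  obtains \<delta> where "\<delta> > 0" "\<And>z. \<bar>z\<bar> < \<delta> \<Longrightarrow> \<exists>u\<in>K. \<exists>v\<in>K. z = u - v"
proof -
  have K: "K \<in> lmeasurable" using assms(1) by (rule lmeasurable_compact)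
  then have pos: "measure lebesgue K > 0"
    using assms(2) by (simp add: negligible_iff_measure zero_less_measure_iff)
  obtain U where U: "open U" "K \<subseteq> U" "U - K \<in> lmeasurable" "emeasure lebesgue (U - K) < ennreal (measure lebesgue K)"
    using sets_lebesgue_outer_open[OF fmeasurableD[OF K] pos] by metis
  have less: "measure lebesgue (U - K) < measure lebesgue K"
    using U(3,4) pos by (simp add: emeasure_eq_measure2 ennreal_less_iff)
  obtain \<delta> where \<delta>: "\<delta> > 0" "(\<Union>x\<in>K. ball x \<delta>) \<subseteq> U"
    using compact_subset_open_imp_ball_epsilon_subset[OF assms(1) U(1,2)] by metis
  show ?thesis
  proof (rule that[OF \<delta>(1)])
    fix z :: real assume z: "\<bar>z\<bar> < \<delta>"
    show "\<exists>u\<in>K. \<exists>v\<in>K. z = u - v"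
    proof (rule ccontr)
      assume no: "\<not> ?thesis"
      have "(+) z ` K \<subseteq> U - K"
      proof
        fix x assume "x \<in> (+) z ` K"
        then obtain v where v: "v \<in> K" "x = z + v" by auto
        then have "x \<in> ball v \<delta>" using z by (simp add: dist_real_def)
        moreover have "x \<notin> K" using no v by force
        ultimately show "x \<in> U - K" using \<delta>(2) v by blast
      qed
      then have "measure lebesgue ((+) z ` K) \<le> measure lebesgue (U - K)"
        using K U(3) by (intro measure_mono_fmeasurable) (auto intro: fmeasurableD measurable_translation)
      with less show False by (simp add: measure_translation)
    qed
  qed
qed

text \<open>The Steinhaus theorem for sums, because a semigroup is closed under sums but not under
  differences.\<close>

lemma sumset_contains_interval:
  fixes S :: "real set"
  assumes "S \<in> sets lebesgue" and "\<not> negligible S"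
  obtains \<delta> z where "\<delta> > 0" "\<And>w. \<bar>w\<bar> < \<delta> \<Longrightarrow> \<exists>u\<in>S. \<exists>v\<in>S. z + w = u + v"
proof -
  obtain K where K: "compact K" "K \<subseteq> S" "\<not> negligible K"
    using compact_inner_non_negligible[OF assms] .
  have [measurable]: "K \<in> sets borel" using K(1) by (rule borel_compact)
  have K0: "emeasure lborel K \<noteq> 0"
    using K(3) by (auto simp: negligible_iff_null_sets null_sets_def)
  text \<open>\<open>K \<inter> (z - K)\<close> is symmetric about \<open>z / 2\<close>, so that its sums are differences.\<close>
  have "\<exists>z. \<not> negligible (K \<inter> (\<lambda>x. z - x) ` K)"
  proof (rule ccontr)
    assume neg: "\<not> ?thesis"
    have refl: "(\<lambda>x. z - x) ` K = (\<lambda>x. z - x) -` K" for z :: real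
      by (auto simp: image_iff) (metis diff_diff_eq2 add_diff_cancel_left')
    \<comment> \<open>The convolution of the indicator of K with itself has total integral equal to
      the square of the measure of K. If all the intersections were null sets, it would vanish
      identically.\<close>
    have "(\<integral>\<^sup>+ z. (\<integral>\<^sup>+ x. indicator K x * indicator K (z - x) \<partial>lborel) \<partial>lborel) =
        (\<integral>\<^sup>+ x. (\<integral>\<^sup>+ z. indicator K x * indicator K (z - x) \<partial>lborel) \<partial>lborel)"
      by (rule lborel_pair.Fubini') measurable
    also have "\<dots> = (\<integral>\<^sup>+ x. indicator K x * emeasure lborel K \<partial>lborel)"
    proof (rule nn_integral_cong)
      fix x :: real
      have "(\<integral>\<^sup>+ z. indicator K (z - x) \<partial>lborel) = (\<integral>\<^sup>+ z. indicator K z \<partial>lborel)"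
        using nn_integral_real_affine[of "indicator K" 1 "-x"] by simp
      then show "(\<integral>\<^sup>+ z. indicator K x * indicator K (z - x) \<partial>lborel) = indicator K x * emeasure lborel K"
        by (simp add: nn_integral_cmult)
    qed
    also have "\<dots> = emeasure lborel K * emeasure lborel K"
      by (simp add: nn_integral_multc)
    finally have "(\<integral>\<^sup>+ z. (\<integral>\<^sup>+ x. indicator K x * indicator K (z - x) \<partial>lborel) \<partial>lborel) \<noteq> 0"
      using K0 by simp
    moreover have "(\<integral>\<^sup>+ x. indicator K x * indicator K (z - x) \<partial>lborel) = 0" for z
    proof -
      have "(\<lambda>x. z - x) -` K \<in> sets borel"
        unfolding refl[symmetric] by (intro borel_compact compact_continuous_image K continuous_intros)
      then have sets: "K \<inter> (\<lambda>x. z - x) -` K \<in> sets borel" by auto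
      have "(\<integral>\<^sup>+ x. indicator K x * indicator K (z - x) \<partial>lborel) =
          (\<integral>\<^sup>+ x. indicator (K \<inter> (\<lambda>x. z - x) -` K) x \<partial>lborel)"
        by (intro nn_integral_cong) (auto simp: indicator_def)
      also have "\<dots> = emeasure lborel (K \<inter> (\<lambda>x. z - x) -` K)"
        by (intro nn_integral_indicator) (simp add: sets)
      also have "\<dots> = emeasure lebesgue (K \<inter> (\<lambda>x. z - x) -` K)"
        by (simp add: sets)
      also have "\<dots> = 0"
        using neg[simplified, rule_format, of z]
        by (simp add: refl negligible_iff_null_sets null_sets_def sets)
      finally show ?thesis .
    qed
    ultimately show False by simp
  qed
  then obtain z where z: "\<not> negligible (K \<inter> (\<lambda>x. z - x) ` K)" by blast
  have "compact (K \<inter> (\<lambda>x. z - x) ` K)"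
    by (intro compact_Int K compact_continuous_image continuous_intros)
  from steinhaus_compact[OF this z] obtain \<delta> where \<delta>: "\<delta> > 0"
    "\<And>w. \<bar>w\<bar> < \<delta> \<Longrightarrow> \<exists>u\<in>K \<inter> (\<lambda>x. z - x) ` K. \<exists>v\<in>K \<inter> (\<lambda>x. z - x) ` K. w = u - v"
    by metis
  show ?thesis
  proof (rule that[OF \<delta>(1), of z])
    fix w :: real assume "\<bar>w\<bar> < \<delta>"
    then obtain u v where "u \<in> K" "v \<in> K" "w = u - (z - v)" using \<delta>(2)[of w] by blast
    then show "\<exists>u\<in>S. \<exists>v\<in>S. z + w = u + v"
      using K(2) by (intro bexI[of _ u] bexI[of _ v]) auto
  qed
qed

text \<open>Adding m elements near z fills an interval of radius m \<delta> around m z. Once that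
  radius exceeds p and -q, its translates by multiples of p and of q cover the line in both
  directions.\<close>

lemma real_subsemigroup_eq_UNIV:
  fixes H :: "real set"
  assumes add: "\<And>x y. x \<in> H \<Longrightarrow> y \<in> H \<Longrightarrow> x + y \<in> H"
    and S: "S \<in> sets lebesgue" "\<not> negligible S" "S \<subseteq> H"
    and p: "p \<in> H" "p > 0" and q: "q \<in> H" "q < 0"
  shows "H = UNIV"
proof -
  obtain \<delta> z where \<delta>: "\<delta> > 0" "\<And>w. \<bar>w\<bar> < \<delta> \<Longrightarrow> \<exists>u\<in>S. \<exists>v\<in>S. z + w = u + v"
    using sumset_contains_interval[OF S(1,2)] by blast
  have base: "z + w \<in> H" if "\<bar>w\<bar> < \<delta>" for w
    using \<delta>(2)[OF that] S(3) add by (metis subsetD)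
  \<comment> \<open>Only positive multiples are available, since 0 is not known to lie in H.\<close>
  have mult: "real (Suc m) * x \<in> H" if "x \<in> H" for m x
  proof (induction m)
    case (Suc m)
    from add[OF this that] show ?case by (simp add: algebra_simps)
  qed (use that in simp)
  have shift: "x + real a * r \<in> H" if "x \<in> H" "r \<in> H" for x a r
  proof (cases a)
    case (Suc b)
    then show ?thesis using add[OF that(1) mult[OF that(2), of b]] by simp
  qed (use that in simp)
  have "r \<in> H" for r
  proof -
    \<comment> \<open>The remainder of s after removing copies of p lies in
      [0, p), or of q in (q, 0]; this k makes both ranges fit into the interval.\<close>
    obtain k where k: "max p (- q) < real k * \<delta>" using reals_Archimedean3[OF \<delta>(1)] by blast
    let ?m = "Suc k"
    have m: "max p (- q) < real ?m * \<delta>" using k \<delta>(1) by (simp add: algebra_simps)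
    have near: "real ?m * z + w \<in> H" if "\<bar>w\<bar> < real ?m * \<delta>" for w
    proof -
      have "\<bar>w / real ?m\<bar> < \<delta>" using that by (simp add: field_simps)
      from mult[OF base[OF this], of k] show ?thesis
        by (simp add: distrib_left del: of_nat_Suc)
    qed
    define s where "s = r - real ?m * z"
    show ?thesis
    proof (cases "s \<ge> 0")
      case True
      define a where "a = nat \<lfloor>s / p\<rfloor>"
      have a: "real a = of_int \<lfloor>s / p\<rfloor>" using True p by (simp add: a_def)
      have "real a \<le> s / p" "s / p < real a + 1" unfolding a by linarith+
      then have "0 \<le> s - real a * p" "s - real a * p < p" using p by (auto simp: field_simps)
      then have "\<bar>s - real a * p\<bar> < real ?m * \<delta>" using m by auto
      from shift[OF near[OF this] p(1), of a] show ?thesis by (simp add: s_def)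
    next
      case False
      define a where "a = nat \<lfloor>s / q\<rfloor>"
      have a: "real a = of_int \<lfloor>s / q\<rfloor>" using False q by (simp add: a_def divide_nonpos_neg)
      have "real a \<le> s / q" "s / q < real a + 1" unfolding a by linarith+
      then have "s - real a * q \<le> 0" "q < s - real a * q" using q by (auto simp: field_simps)
      then have "\<bar>s - real a * q\<bar> < real ?m * \<delta>" using m by auto
      from shift[OF near[OF this] q(1), of a] show ?thesis by (simp add: s_def)
    qed
  qed
  then show ?thesis by auto
qed

section \<open>Measurable matrix groups and their cocycles\<close>

lemma row_matrix_mult: "(X ** Y) $ i = X $ i v* Y"
  for X :: "real ^ 'n ^ 'm" and Y :: "real ^ 'k ^ 'n::finite"
  by (simp add: vec_eq_iff vector_matrix_mult_def matrix_matrix_mult_def mult.commute)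

lemma vector_matrix_mult_component: "(x v* Y) $ j = (\<Sum>i\<in>UNIV. x $ i * Y $ i $ j)"
  for Y :: "real ^ 'k ^ 'n::finite"
  by (simp add: vector_matrix_mult_def mult.commute)

lemma matrix_mult_component: "(X ** Y) $ i $ j = (\<Sum>k\<in>UNIV. X $ i $ k * Y $ k $ j)"
  for X :: "real ^ 'n ^ 'm" and Y :: "real ^ 'k ^ 'n::finite"
  by (simp add: matrix_matrix_mult_def)

lemma has_integral_translate_real:
  fixes f :: "real \<Rightarrow> real"
  assumes "(f has_integral I) {a + u..b + u}"
  shows "((\<lambda>x. f (u + x)) has_integral I) {a..b}"
proof -
  have "((\<lambda>x. f (1 *\<^sub>R x + u)) has_integral I) ((\<lambda>x. x - u) ` {a + u..b + u})"
    using has_integral_affinity[of f I "a + u" "b + u" 1 u] assms by (simp add: cbox_interval)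
  moreover have "(\<lambda>x. x - u) ` {a + u..b + u} = {a..b}"
    by (auto simp: image_iff intro!: bexI[of _ "_ + u"])
  ultimately show ?thesis by (simp add: add.commute)
qed

section \<open>Cocycles over a measurable triangular matrix group\<close>

locale one_parameter_group =
  fixes A :: "real \<Rightarrow> real ^ 'n::{finite,wellorder} ^ 'n::{finite,wellorder}"
  assumes A_measurable: "\<And>i j. (\<lambda>u. A u $ i $ j) \<in> borel_measurable lebesgue"
    and A_zero: "A 0 = mat 1"
    and A_add: "\<And>u v. A (u + v) = A u ** A v"
    and A_upper: "\<And>u i j. j < i \<Longrightarrow> A u $ i $ j = 0"
begin

lemma A_diag_add: "A (u + v) $ i $ i = A u $ i $ i * A v $ i $ i"
proof -
  have "A (u + v) $ i $ i = (\<Sum>k\<in>UNIV. A u $ i $ k * A v $ k $ i)"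
    by (simp add: A_add matrix_mult_component)
  also have "\<dots> = (\<Sum>k\<in>UNIV. if k = i then A u $ i $ k * A v $ k $ i else 0)"
    by (rule sum.cong) (auto simp: A_upper elim: neqE)
  finally show ?thesis by simp
qed

text \<open>The entry is the square of the entry at u / 2, and it is non-zero because the entry at
  -u is its inverse.\<close>

lemma A_diag_pos: "A u $ i $ i > 0"
proof -
  have "A u $ i $ i = A (u / 2) $ i $ i * A (u / 2) $ i $ i"
    using A_diag_add[of "u / 2" "u / 2" i] by simp
  moreover have "A u $ i $ i * A (- u) $ i $ i = 1"
    using A_diag_add[of u "- u" i] by (simp add: A_zero mat_def)
  ultimately show ?thesis by (metis mult_zero_left not_square_less_zero not_less_iff_gr_or_eq zero_neq_one)
qed

text \<open>A measurable 1-cocycle (crossed homomorphism) of the additive group of the reals acting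
  on row vectors from the right by A.\<close>

definition cocycle :: "(real \<Rightarrow> real ^ 'n::{finite,wellorder}) \<Rightarrow> bool" where
  "cocycle h \<longleftrightarrow> (\<forall>j. (\<lambda>u. h u $ j) \<in> borel_measurable lebesgue) \<and> (\<forall>u v. h (u + v) = h v + h u v* A v)"

lemma cocycle_add: "cocycle h \<Longrightarrow> h (u + v) = h v + h u v* A v"
  by (simp add: cocycle_def)

lemma cocycle_zero: "cocycle h \<Longrightarrow> h 0 = 0"
  using cocycle_add[of h 0 0] by (simp add: A_zero)

lemma cocycle_diff:
  assumes "cocycle h"
  shows "h (u - v) = (h u - h v) v* A (- v)"
proof -
  have "h (- v) = - (h v v* A (- v))"
    using cocycle_add[OF assms, of v "- v"] cocycle_zero[OF assms] by (simp add: eq_neg_iff_add_eq_0)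
  with cocycle_add[OF assms, of u "- v"] show ?thesis
    by (simp add: algebra_simps)
qed

text \<open>Makes the regularity results for cocycles applicable to A itself.\<close>

lemma cocycle_row: "cocycle (\<lambda>u. A u $ i - mat 1 $ i)"
  unfolding cocycle_def
proof (intro conjI allI)
  show "(\<lambda>u. (A u $ i - mat 1 $ i) $ j) \<in> borel_measurable lebesgue" for j
    using A_measurable[of i j] by simp
  show "A (u + v) $ i - mat 1 $ i = A v $ i - mat 1 $ i + (A u $ i - mat 1 $ i) v* A v" for u v
    using row_matrix_mult[of "mat 1" "A v" i] by (simp add: A_add row_matrix_mult algebra_simps)
qed

text \<open>Countably many level sets S K cover the line, so one is not negligible, and by Steinhaus
  every small z is u - v with u and v in it. Both \<open>A z\<close> and \<open>h z\<close> are then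
  products with \<open>A (- v)\<close>, which is why S K also bounds A at -u.\<close>

lemma locally_bounded:
  assumes h: "cocycle h"
  obtains \<delta> C where "\<delta> > 0" "C > 0"
    "\<And>u i j. \<bar>u\<bar> < \<delta> \<Longrightarrow> \<bar>A u $ i $ j\<bar> \<le> C" "\<And>u j. \<bar>u\<bar> < \<delta> \<Longrightarrow> \<bar>h u $ j\<bar> \<le> C"
proof -
  define S where "S K = {u. (\<forall>i j. \<bar>A u $ i $ j\<bar> \<le> real K) \<and> (\<forall>i j. \<bar>A (- u) $ i $ j\<bar> \<le> real K)
    \<and> (\<forall>j. \<bar>h u $ j\<bar> \<le> real K)}" for K
  have [measurable]: "(\<lambda>u. A u $ i $ j) \<in> borel_measurable lebesgue" for i j by (rule A_measurable)
  have [measurable]: "(\<lambda>u. A (- u) $ i $ j) \<in> borel_measurable lebesgue" for i j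
    using measurable_compose[OF lebesgue_measurable_scaling[of "-1"] A_measurable[of i j]] by simp
  have [measurable]: "(\<lambda>u. h u $ j) \<in> borel_measurable lebesgue" for j
    using h by (simp add: cocycle_def)
  have "{u \<in> space lebesgue. (\<forall>i j. \<bar>A u $ i $ j\<bar> \<le> real K) \<and> (\<forall>i j. \<bar>A (- u) $ i $ j\<bar> \<le> real K)
    \<and> (\<forall>j. \<bar>h u $ j\<bar> \<le> real K)} \<in> sets lebesgue" for K
    by measurable
  then have sets: "S K \<in> sets lebesgue" for K
    by (simp add: S_def)
  have "u \<in> (\<Union>K. S K)" for u
  proof -
    let ?b = "(\<Sum>i\<in>UNIV. \<Sum>j\<in>UNIV. \<bar>A u $ i $ j\<bar>) + (\<Sum>i\<in>UNIV. \<Sum>j\<in>UNIV. \<bar>A (- u) $ i $ j\<bar>) + (\<Sum>j\<in>UNIV. \<bar>h u $ j\<bar>)"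
    obtain K where K: "?b \<le> real K" using real_arch_simple by blast
    have two: "\<bar>M $ i $ j\<bar> \<le> (\<Sum>i\<in>UNIV. \<Sum>j\<in>UNIV. \<bar>M $ i $ j\<bar>)" for M :: "real ^ 'n::{finite,wellorder} ^ 'n::{finite,wellorder}" and i j
      by (rule order_trans[OF member_le_sum[of j UNIV "\<lambda>j. \<bar>M $ i $ j\<bar>"] member_le_sum[of i UNIV "\<lambda>i. \<Sum>j\<in>UNIV. \<bar>M $ i $ j\<bar>"]])
        (auto intro: sum_nonneg)
    have one: "\<bar>v $ j\<bar> \<le> (\<Sum>j\<in>UNIV. \<bar>v $ j\<bar>)" for v :: "real ^ 'n::{finite,wellorder}" and j
      by (rule member_le_sum) auto
    have nonneg: "0 \<le> (\<Sum>i\<in>UNIV. \<Sum>j\<in>UNIV. \<bar>M $ i $ j\<bar>)" for M :: "real ^ 'n::{finite,wellorder} ^ 'n::{finite,wellorder}"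
      by (intro sum_nonneg) auto
    have nonneg': "0 \<le> (\<Sum>j\<in>UNIV. \<bar>v $ j\<bar>)" for v :: "real ^ 'n::{finite,wellorder}"
      by (intro sum_nonneg) auto
    have "u \<in> S K"
      unfolding S_def
    proof (intro CollectI conjI allI)
      show "\<bar>A u $ i $ j\<bar> \<le> real K" for i j
        using K two[of "A u" i j] nonneg[of "A (- u)"] nonneg'[of "h u"] by linarith
      show "\<bar>A (- u) $ i $ j\<bar> \<le> real K" for i j
        using K two[of "A (- u)" i j] nonneg[of "A u"] nonneg'[of "h u"] by linarith
      show "\<bar>h u $ j\<bar> \<le> real K" for j
        using K one[of "h u" j] nonneg[of "A u"] nonneg[of "A (- u)"] by linarith
    qed
    then show ?thesis by blast
  qed
  then have "(\<Union>K. S K) = UNIV" by blast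
  then obtain K where K: "\<not> negligible (S K)"
    using negligible_countable_Union[of "range S"] by auto
  obtain Q where Q: "compact Q" "Q \<subseteq> S K" "\<not> negligible Q"
    using compact_inner_non_negligible[OF sets K] .
  obtain \<delta> where \<delta>: "\<delta> > 0" "\<And>z. \<bar>z\<bar> < \<delta> \<Longrightarrow> \<exists>u\<in>Q. \<exists>v\<in>Q. z = u - v"
    using steinhaus_compact[OF Q(1,3)] by blast
  \<comment> \<open>2 K bounds the entries of h u - h v, K those of \<open>A (- v)\<close>, and the
    sums have CARD('n) terms; the summand 1 makes C positive.\<close>
  define C where "C = real CARD('n) * (2 * real K * real K) + 1"
  have bound: "\<bar>\<Sum>k\<in>UNIV. x k * y k\<bar> \<le> C"
    if "\<And>k. \<bar>x k\<bar> \<le> 2 * real K" "\<And>k. \<bar>y k\<bar> \<le> real K" for x y :: "'n \<Rightarrow> real"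
  proof -
    have "\<bar>\<Sum>k\<in>UNIV. x k * y k\<bar> \<le> (\<Sum>k\<in>(UNIV::'n set). 2 * real K * real K)"
      by (rule order_trans[OF sum_abs sum_mono]) (auto simp: abs_mult intro!: mult_mono that)
    then show ?thesis by (simp add: C_def)
  qed
  show ?thesis
  proof (rule that[of \<delta> C])
    show "\<delta> > 0" by fact
    show "C > 0" by (simp add: C_def add_nonneg_pos)
    fix z :: real assume "\<bar>z\<bar> < \<delta>"
    then obtain u v where z: "z = u - v" and uv: "u \<in> S K" "v \<in> S K" using \<delta>(2) Q(2) by blast
    show "\<bar>A z $ i $ j\<bar> \<le> C" for i j
    proof -
      have "A z $ i $ j = (\<Sum>k\<in>UNIV. A u $ i $ k * A (- v) $ k $ j)"
        using A_add[of u "- v"] by (simp add: z matrix_mult_component)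
      moreover have "\<bar>A u $ i $ k\<bar> \<le> 2 * real K" for k
        using uv(1) by (auto simp: S_def intro: order_trans[of _ "real K"])
      ultimately show ?thesis using bound[of "\<lambda>k. A u $ i $ k" "\<lambda>k. A (- v) $ k $ j"] uv(2) by (simp add: S_def)
    qed
    show "\<bar>h z $ j\<bar> \<le> C" for j
    proof -
      have "h z $ j = (\<Sum>k\<in>UNIV. (h u - h v) $ k * A (- v) $ k $ j)"
        using cocycle_diff[OF h, of u v] by (simp add: z vector_matrix_mult_component)
      moreover have "\<bar>(h u - h v) $ k\<bar> \<le> 2 * real K" for k
      proof -
        have "\<bar>h u $ k\<bar> \<le> real K" "\<bar>h v $ k\<bar> \<le> real K" using uv by (auto simp: S_def)
        then show ?thesis by simp
      qed
      ultimately show ?thesis using bound[of "\<lambda>k. (h u - h v) $ k" "\<lambda>k. A (- v) $ k $ j"] uv(2) by (simp add: S_def)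
    qed
  qed
qed

text \<open>
  Integrating the cocycle equation in \<open>v\<close> expresses \<open>h u\<close> times an invertible matrix through an
  indefinite integral of \<open>h\<close>. This is used twice, for continuity and then for differentiability.
\<close>

lemma cocycle_has_derivative:
  assumes h: "cocycle h"
  shows "\<exists>c. \<forall>v j. ((\<lambda>u. h u $ j) has_real_derivative (c v* A v) $ j) (at v)"
proof -
  obtain \<delta> C where \<delta>: "\<delta> > 0" and C: "C > 0"
    and A_le: "\<And>u i j. \<bar>u\<bar> < \<delta> \<Longrightarrow> \<bar>A u $ i $ j\<bar> \<le> C" and h_le: "\<And>u j. \<bar>u\<bar> < \<delta> \<Longrightarrow> \<bar>h u $ j\<bar> \<le> C"
    using locally_bounded[OF h] by metis
  \<comment> \<open>For u in [-e, e] and v in [0, e] all arguments stay in [-2e, 2e], well inside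
    the region |u| < \<delta> where A and h are bounded.\<close>
  define e where "e = \<delta> / 4"
  have e: "e > 0" using \<delta> by (simp add: e_def)
  have integrable: "f integrable_on {a..b}"
    if "f \<in> borel_measurable lebesgue" "\<And>u. \<bar>u\<bar> < \<delta> \<Longrightarrow> \<bar>f u\<bar> \<le> C" "- 2 * e \<le> a" "b \<le> 2 * e" for f :: "real \<Rightarrow> real" and a b
  proof (rule measurable_bounded_by_integrable_imp_integrable)
    show "f \<in> borel_measurable (lebesgue_on {a..b})" by (rule measurable_restrict_space1[OF that(1)])
    show "(\<lambda>u. C) integrable_on {a..b}" by (rule integrable_const_ivl)
    show "norm (f u) \<le> C" if "u \<in> {a..b}" for u
      using that \<open>- 2 * e \<le> a\<close> \<open>b \<le> 2 * e\<close> \<delta> \<open>\<And>u. \<bar>u\<bar> < \<delta> \<Longrightarrow> \<bar>f u\<bar> \<le> C\<close>[of u]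
      by (auto simp: e_def)
  qed simp
  have h_int: "(\<lambda>u. h u $ j) integrable_on {a..b}" if "- 2 * e \<le> a" "b \<le> 2 * e" for a b j
    using h h_le that by (intro integrable) (auto simp: cocycle_def)
  have A_int: "(\<lambda>u. A u $ i $ j) integrable_on {0..e}" for i j
    using A_le e by (intro integrable A_measurable) auto
  \<comment> \<open>W is the factor that \<open>h u\<close> acquires on integration over v. It is
    invertible: it is triangular, and its diagonal is positive because \<open>A u $ i $ i\<close> is
    at least 1 / C, its inverse being an entry of \<open>A (- u)\<close>.\<close>
  define W :: "real ^ 'n::{finite,wellorder} ^ 'n::{finite,wellorder}"
    where "W = (\<chi> i j. integral {0..e} (\<lambda>u. A u $ i $ j))"
  have W_upper: "W $ i $ j = 0" if "j < i" for i j
    using that by (simp add: W_def A_upper)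
  have W_diag: "W $ i $ i > 0" for i
  proof -
    have "1 / C \<le> A u $ i $ i" if "u \<in> {0..e}" for u
    proof -
      have "A u $ i $ i * A (- u) $ i $ i = 1"
        using A_diag_add[of u "- u" i] by (simp add: A_zero mat_def)
      moreover have "A (- u) $ i $ i \<le> C" using A_le[of "- u" i i] that \<delta> by (auto simp: e_def)
      ultimately have "1 \<le> A u $ i $ i * C"
        using A_diag_pos[of u i] by (metis mult_left_mono less_imp_le)
      then show ?thesis using C by (simp add: field_simps)
    qed
    then have "integral {0..e} (\<lambda>u. 1 / C) \<le> integral {0..e} (\<lambda>u. A u $ i $ i)"
      by (intro integral_le integrable_const_ivl A_int)
    then have "integral {0..e} (\<lambda>u. 1 / C) \<le> W $ i $ i"
      unfolding W_def by simp
    moreover have "0 < integral {0..e} (\<lambda>u. 1 / C)" using e C by simp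
    ultimately show ?thesis by linarith
  qed
  have "det W = (\<Prod>i\<in>UNIV. W $ i $ i)" by (rule det_upperdiagonal) (simp add: W_upper)
  also have "\<dots> \<noteq> 0" using W_diag by (simp add: less_imp_neq[symmetric])
  finally obtain R where R: "W ** R = mat 1"
    by (metis invertible_det_nz invertible_def)
  define \<Phi> where "\<Phi> j x = integral {- 2 * e..x} (\<lambda>u. h u $ j)" for j x
  \<comment> \<open>The integral of h (u + v) over v in [0, e] is \<Phi> (u + e) - \<Phi> u.
    Removing the integral of h v leaves \<open>h u v* W\<close>.\<close>
  define \<Psi> where "\<Psi> u = (\<chi> j. \<Phi> j (u + e) - \<Phi> j u - integral {0..e} (\<lambda>v. h v $ j))" for u
  have hW: "h u v* W = \<Psi> u" if u: "u \<in> {- e..e}" for u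
  proof -
    have "(h u v* W) $ j = \<Psi> u $ j" for j
    proof -
      have "((\<lambda>v. h v $ j + (\<Sum>i\<in>UNIV. h u $ i * A v $ i $ j)) has_integral
          integral {0..e} (\<lambda>v. h v $ j) + (\<Sum>i\<in>UNIV. h u $ i * W $ i $ j)) {0..e}"
        using A_int h_int[of 0 e j] e
        by (intro has_integral_add has_integral_sum has_integral_mult_right)
          (auto simp: W_def intro: integrable_integral)
      then have 1: "((\<lambda>v. h (u + v) $ j) has_integral
          integral {0..e} (\<lambda>v. h v $ j) + (\<Sum>i\<in>UNIV. h u $ i * W $ i $ j)) {0..e}"
        by (simp add: cocycle_add[OF h] vector_matrix_mult_component)
      have "((\<lambda>v. h v $ j) has_integral integral {u..u + e} (\<lambda>v. h v $ j)) {0 + u..e + u}"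
        using integrable_integral[OF h_int[of u "u + e" j]] u by (simp add: add.commute)
      from has_integral_unique[OF 1 has_integral_translate_real[OF this]]
      have "integral {0..e} (\<lambda>v. h v $ j) + (\<Sum>i\<in>UNIV. h u $ i * W $ i $ j) = integral {u..u + e} (\<lambda>v. h v $ j)" .
      moreover have "\<Phi> j u + integral {u..u + e} (\<lambda>v. h v $ j) = \<Phi> j (u + e)"
        unfolding \<Phi>_def using u e by (intro Henstock_Kurzweil_Integration.integral_combine h_int) auto
      ultimately show ?thesis by (simp add: \<Psi>_def vector_matrix_mult_component)
    qed
    then show ?thesis by (simp add: vec_eq_iff)
  qed
  have h_eq: "h u $ j = (\<Sum>i\<in>UNIV. \<Psi> u $ i * R $ i $ j)" if "u \<in> {- e..e}" for u j
  proof -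
    have "h u = (h u v* W) v* R" by (simp add: vector_matrix_mul_assoc R)
    then show ?thesis by (metis hW[OF that] vector_matrix_mult_component)
  qed
  have near: "\<forall>\<^sub>F u in nhds 0. u \<in> {- e<..<e}"
    using e by (intro eventually_nhds_in_open) auto
  have \<Phi>_cont: "continuous_on {- 2 * e..2 * e} (\<Phi> j)" for j
    unfolding \<Phi>_def by (intro indefinite_integral_continuous_1 h_int) auto
  have \<Phi>_isCont: "isCont (\<Phi> j) x" if "x \<in> {- 2 * e<..<2 * e}" for j x
    by (rule continuous_on_interior[OF \<Phi>_cont]) (use that in simp)
  have \<Psi>_isCont: "isCont (\<lambda>u. \<Psi> u $ j) 0" for j
    unfolding \<Psi>_def using e
    by (auto intro!: continuous_intros \<Phi>_isCont isCont_o2[where g = "\<Phi> j" and f = "\<lambda>u. u + e"])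
  have "isCont (\<lambda>u. h u $ j) 0" for j
  proof (rule iffD2[OF isCont_cong])
    show "\<forall>\<^sub>F u in nhds 0. h u $ j = (\<Sum>i\<in>UNIV. \<Psi> u $ i * R $ i $ j)"
      using near by eventually_elim (rule h_eq, auto)
    show "isCont (\<lambda>u. \<Sum>i\<in>UNIV. \<Psi> u $ i * R $ i $ j) 0"
      by (intro continuous_intros \<Psi>_isCont)
  qed
  then have h0: "((\<lambda>u. h u $ j) \<longlongrightarrow> 0) (at 0)" for j
    using cocycle_zero[OF h] by (simp add: isCont_def)
  have h_isCont: "isCont (\<lambda>u. h u $ j) v" for j v
  proof -
    have "((\<lambda>u. h v $ j + (\<Sum>i\<in>UNIV. h u $ i * A v $ i $ j)) \<longlongrightarrow> h v $ j + (\<Sum>i\<in>UNIV. 0 * A v $ i $ j)) (at 0)"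
      by (intro tendsto_intros h0)
    then have "((\<lambda>u. h (u + v) $ j) \<longlongrightarrow> h v $ j) (at 0)"
      by (simp add: cocycle_add[OF h] vector_matrix_mult_component)
    then show ?thesis by (simp add: isCont_iff add.commute[of v])
  qed
  \<comment> \<open>Second pass: h is now continuous everywhere, so its indefinite integral is
    differentiable, and then so is h through the formula for \<Psi>.\<close>
  have \<Phi>_deriv: "(\<Phi> j has_real_derivative h x $ j) (at x)" if "x \<in> {- 2 * e<..<2 * e}" for j x
  proof -
    have "(\<Phi> j has_vector_derivative h x $ j) (at x within {- 2 * e..2 * e})"
      unfolding \<Phi>_def using that
      by (intro integral_has_vector_derivative continuous_at_imp_continuous_on ballI h_isCont) auto
    then show ?thesis
      using that by (simp add: at_within_Icc_at has_real_derivative_iff_has_vector_derivative)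
  qed
  \<comment> \<open>The derivative of \<Psi> at 0 is h e - h 0; multiplying by the inverse R of W
    gives that of h.\<close>
  define c where "c = (\<chi> j. \<Sum>i\<in>UNIV. (h e $ i - h 0 $ i) * R $ i $ j)"
  have deriv0: "((\<lambda>u. h u $ j) has_real_derivative c $ j) (at 0)" for j
  proof (rule iffD2[OF DERIV_cong_ev[OF refl _ refl]])
    show "\<forall>\<^sub>F u in nhds 0. h u $ j = (\<Sum>i\<in>UNIV. \<Psi> u $ i * R $ i $ j)"
      using near by eventually_elim (rule h_eq, auto)
    have shift: "((\<lambda>u. \<Phi> i (u + e)) has_real_derivative h e $ i) (at 0)" for i
      using \<Phi>_deriv[of e i] e by (simp add: DERIV_shift[symmetric] flip: DERIV_shift[of _ _ 0 e])
    show "((\<lambda>u. \<Sum>i\<in>UNIV. \<Psi> u $ i * R $ i $ j) has_real_derivative c $ j) (at 0)"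
      unfolding \<Psi>_def c_def using e
      by (auto intro!: derivative_eq_intros shift \<Phi>_deriv)
  qed
  have "((\<lambda>u. h u $ j) has_real_derivative (c v* A v) $ j) (at v)" for v j
  proof -
    have "((\<lambda>u. h v $ j + (\<Sum>i\<in>UNIV. h u $ i * A v $ i $ j)) has_real_derivative (c v* A v) $ j) (at 0)"
      by (auto intro!: derivative_eq_intros deriv0 simp: vector_matrix_mult_component)
    then have "((\<lambda>u. h (u + v) $ j) has_real_derivative (c v* A v) $ j) (at 0)"
      by (simp add: cocycle_add[OF h] vector_matrix_mult_component)
    then show ?thesis using DERIV_shift[of "\<lambda>u. h u $ j" _ 0 v] by simp
  qed
  then show ?thesis by blast
qed

text \<open>The rows of B are the derivatives of the rows of A at 0, which gives the first formula.
  The second comes from differentiating \<open>A v ** A u\<close> at u = 0; it places B on the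
  right, next to an eigenvector of B.\<close>

lemma generator_exists:
  "\<exists>B. (\<forall>v i j. ((\<lambda>u. A u $ i $ j) has_real_derivative (B ** A v) $ i $ j) (at v)) \<and>
       (\<forall>v i j. ((\<lambda>u. A u $ i $ j) has_real_derivative (A v ** B) $ i $ j) (at v))"
proof -
  have "\<forall>i. \<exists>c. \<forall>v j. ((\<lambda>u. (A u $ i - mat 1 $ i) $ j) has_real_derivative (c v* A v) $ j) (at v)"
    using cocycle_has_derivative[OF cocycle_row] by blast
  then obtain b where b: "\<And>i v j. ((\<lambda>u. (A u $ i - mat 1 $ i) $ j) has_real_derivative (b i v* A v) $ j) (at v)"
    by metis
  define B where "B = (\<chi> i. b i)"
  have left: "((\<lambda>u. A u $ i $ j) has_real_derivative (B ** A v) $ i $ j) (at v)" for v i j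
    using DERIV_add[OF b[of i j v] DERIV_const[of "mat 1 $ i $ j"]] by (simp add: B_def row_matrix_mult)
  have "((\<lambda>u. A u $ i $ j) has_real_derivative (A v ** B) $ i $ j) (at v)" for v i j
  proof -
    have "((\<lambda>u. \<Sum>k\<in>UNIV. A v $ i $ k * A u $ k $ j) has_real_derivative (A v ** B) $ i $ j) (at 0)"
      using left[of _ _ 0] by (auto intro!: derivative_eq_intros simp: matrix_mult_component[of "A v"] A_zero mult.commute)
    then have "((\<lambda>u. A (u + v) $ i $ j) has_real_derivative (A v ** B) $ i $ j) (at 0)"
      by (simp add: matrix_mult_component A_add[of v, unfolded add.commute[of v]])
    then show ?thesis using DERIV_shift[of "\<lambda>u. A u $ i $ j" _ 0 v] by simp
  qed
  with left show ?thesis by blast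
qed

end

section \<open>The generator: matrix exponential, index function, eigenvectors\<close>

context one_parameter_group
begin

text \<open>Maclaurin expansion of each entry of A: the derivatives of order n are entries of A(u)
  times the n-th power of B and grow at most geometrically in n, so the Lagrange remainder is beaten
  by the factorial.\<close>

lemma mat_exp_generator:
  assumes deriv: "\<And>v i j. ((\<lambda>u. A u $ i $ j) has_real_derivative (A v ** B) $ i $ j) (at v)"
  shows "mat_exp (s *\<^sub>R B) = A s"
proof -
  define P where "P k = ((**) B ^^ k) (mat 1)" for k
  have P_Suc: "P (Suc k) = B ** P k" for k by (simp add: P_def)
  have scaled: "((**) (s *\<^sub>R B) ^^ k) (mat 1) = s ^ k *\<^sub>R P k" for k
    by (induction k)
      (auto simp: P_def vec_eq_iff matrix_mult_component sum_distrib_left mult_ac)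
  \<comment> \<open>b dominates every absolute row sum of B, so each multiplication by B costs at
    most a factor b.\<close>
  define b where "b = (\<Sum>i\<in>UNIV. \<Sum>j\<in>UNIV. \<bar>B $ i $ j\<bar>)"
  have P_le: "\<bar>P k $ i $ j\<bar> \<le> b ^ k" for k i j
  proof (induction k arbitrary: i)
    case 0
    show ?case by (simp add: P_def mat_def)
  next
    case (Suc k)
    have "\<bar>P (Suc k) $ i $ j\<bar> \<le> (\<Sum>l\<in>UNIV. \<bar>B $ i $ l\<bar> * \<bar>P k $ l $ j\<bar>)"
      unfolding P_Suc matrix_mult_component by (rule order_trans[OF sum_abs]) (simp add: abs_mult)
    also have "\<dots> \<le> (\<Sum>l\<in>UNIV. \<bar>B $ i $ l\<bar> * b ^ k)"
      by (intro sum_mono mult_left_mono Suc) auto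
    also have "\<dots> = (\<Sum>l\<in>UNIV. \<bar>B $ i $ l\<bar>) * b ^ k"
      by (simp add: sum_distrib_right)
    also have "\<dots> \<le> b * b ^ k"
      unfolding b_def
      by (intro mult_right_mono member_le_sum[of i UNIV "\<lambda>i. \<Sum>j\<in>UNIV. \<bar>B $ i $ j\<bar>"] zero_le_power)
        (auto intro!: sum_nonneg)
    finally show ?case by simp
  qed
  have entry: "(\<lambda>k. s ^ k / fact k * P k $ i $ j) sums A s $ i $ j" for i j
  proof -
    \<comment> \<open>The k-th derivative of the (i, j) entry of A.\<close>
    define diff where "diff k u = (A u ** P k) $ i $ j" for k u
    have diff_deriv: "DERIV (diff k) u :> diff (Suc k) u" for k u
    proof -
      have "((\<lambda>u. \<Sum>l\<in>UNIV. A u $ i $ l * P k $ l $ j) has_real_derivative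
          (\<Sum>l\<in>UNIV. (A u ** B) $ i $ l * P k $ l $ j)) (at u)"
        by (auto intro!: derivative_eq_intros deriv)
      then show ?thesis
        unfolding diff_def P_Suc by (simp add: matrix_mul_assoc flip: matrix_mult_component)
    qed
    have "continuous_on {- \<bar>s\<bar>..\<bar>s\<bar>} (\<lambda>u. \<Sum>l\<in>UNIV. \<bar>A u $ i $ l\<bar>)"
      by (intro continuous_on_sum continuous_on_rabs continuous_at_imp_continuous_on ballI)
        (rule DERIV_isCont[OF deriv])
    from compact_continuous_image[OF this compact_Icc, THEN compact_imp_bounded]
    obtain C where "\<forall>u\<in>{- \<bar>s\<bar>..\<bar>s\<bar>}. norm (\<Sum>l\<in>UNIV. \<bar>A u $ i $ l\<bar>) \<le> C"
      by (auto simp: bounded_iff)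
    then have C: "(\<Sum>l\<in>UNIV. \<bar>A u $ i $ l\<bar>) \<le> C" if "\<bar>u\<bar> \<le> \<bar>s\<bar>" for u
      using that by (auto simp: abs_le_iff)
    have diff_le: "\<bar>diff n u\<bar> \<le> C * b ^ n" if "\<bar>u\<bar> \<le> \<bar>s\<bar>" for n u
    proof -
      have "\<bar>diff n u\<bar> \<le> (\<Sum>l\<in>UNIV. \<bar>A u $ i $ l\<bar> * \<bar>P n $ l $ j\<bar>)"
        unfolding diff_def matrix_mult_component by (rule order_trans[OF sum_abs]) (simp add: abs_mult)
      also have "\<dots> \<le> (\<Sum>l\<in>UNIV. \<bar>A u $ i $ l\<bar> * b ^ n)"
        by (intro sum_mono mult_left_mono P_le) auto
      also have "\<dots> = (\<Sum>l\<in>UNIV. \<bar>A u $ i $ l\<bar>) * b ^ n"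
        by (simp add: sum_distrib_right)
      also have "\<dots> \<le> C * b ^ n"
        using P_le[of n i i] by (intro mult_right_mono C that) linarith
      finally show ?thesis .
    qed
    have rem: "\<bar>A s $ i $ j - (\<Sum>k<n. s ^ k / fact k * P k $ i $ j)\<bar> \<le> C * (inverse (fact n) * (b * \<bar>s\<bar>) ^ n)" for n
    proof -
      obtain t where t: "\<bar>t\<bar> \<le> \<bar>s\<bar>"
        "diff 0 s = (\<Sum>m<n. (diff m 0 / fact m) * s ^ m) + (diff n t / fact n) * s ^ n"
        using Maclaurin_all_le[of diff "diff 0" s n] diff_deriv by blast
      have "A s $ i $ j - (\<Sum>k<n. s ^ k / fact k * P k $ i $ j) = (diff n t / fact n) * s ^ n"
        using t(2) by (simp add: diff_def A_zero P_def[of 0] mult.commute)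
      also have "\<bar>\<dots>\<bar> = \<bar>diff n t\<bar> / fact n * \<bar>s\<bar> ^ n"
        by (simp add: abs_mult power_abs)
      also have "\<dots> \<le> C * b ^ n / fact n * \<bar>s\<bar> ^ n"
        by (intro mult_right_mono divide_right_mono diff_le t(1)) auto
      finally show ?thesis by (simp add: field_simps power_mult_distrib)
    qed
    have "(\<lambda>n. C * (inverse (fact n) * (b * \<bar>s\<bar>) ^ n)) \<longlonglongrightarrow> C * 0"
      by (rule tendsto_mult[OF tendsto_const summable_LIMSEQ_zero[OF summable_exp]])
    then have "(\<lambda>n. C * (inverse (fact n) * (b * \<bar>s\<bar>) ^ n)) \<longlonglongrightarrow> 0" by simp
    with always_eventually have "(\<lambda>n. A s $ i $ j - (\<Sum>k<n. s ^ k / fact k * P k $ i $ j)) \<longlonglongrightarrow> 0"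
      by (rule Lim_null_comparison) (simp only: real_norm_def rem simp_thms)
    then have "(\<lambda>n. A s $ i $ j - (A s $ i $ j - (\<Sum>k<n. s ^ k / fact k * P k $ i $ j))) \<longlonglongrightarrow> A s $ i $ j - 0"
      by (rule tendsto_diff[OF tendsto_const])
    then show ?thesis by (simp add: sums_def)
  qed
  have "(\<lambda>k. (1 / fact k) *\<^sub>R (s ^ k *\<^sub>R P k)) sums A s"
    unfolding sums_def
  proof (intro vec_tendstoI)
    fix i j
    show "(\<lambda>n. (\<Sum>k<n. (1 / fact k) *\<^sub>R (s ^ k *\<^sub>R P k)) $ i $ j) \<longlonglongrightarrow> A s $ i $ j"
      using entry[of i j] by (simp add: sums_def)
  qed
  then show ?thesis unfolding mat_exp_def scaled by (rule sums_unique[symmetric])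
qed

lemma generator_upper_triangular:
  assumes deriv: "\<And>i j. ((\<lambda>u. A u $ i $ j) has_real_derivative B $ i $ j) (at 0)" and "j < i"
  shows "B $ i $ j = 0"
proof (rule DERIV_unique)
  show "((\<lambda>u. 0) has_real_derivative B $ i $ j) (at 0)"
    using deriv[of i j] by (simp add: A_upper[OF \<open>j < i\<close>])
qed (rule DERIV_const)

text \<open>Both diagonal entries equal 1 at 0, so their right difference quotients there inherit
  the order.\<close>

lemma generator_diag_mono:
  assumes deriv: "\<And>i j. ((\<lambda>u. A u $ i $ j) has_real_derivative B $ i $ j) (at 0)"
    and mono: "\<And>s. s > 0 \<Longrightarrow> A s $ j $ j \<le> A s $ i $ i"
  shows "B $ j $ j \<le> B $ i $ i"
proof (rule tendsto_le)
  show "((\<lambda>s. (A s $ k $ k - 1) / s) \<longlongrightarrow> B $ k $ k) (at_right 0)" for k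
  proof (rule tendsto_mono[OF at_le[OF subset_UNIV]])
    show "((\<lambda>s. (A s $ k $ k - 1) / s) \<longlongrightarrow> B $ k $ k) (at 0)"
      using deriv[of k k] by (simp add: DERIV_def A_zero mat_def)
  qed
  then show "((\<lambda>s. (A s $ j $ j - 1) / s) \<longlongrightarrow> B $ j $ j) (at_right 0)" .
  show "\<forall>\<^sub>F s in at_right 0. (A s $ j $ j - 1) / s \<le> (A s $ i $ i - 1) / s"
    using eventually_at_right_less[of 0]
    by eventually_elim (intro divide_right_mono diff_right_mono mono, auto)
qed simp

text \<open>By the chain rule h (ln y) is a primitive of c A(ln y) / y, and A(ln y) is the matrix
  power y^B. The constant is h (ln 1) = 0.\<close>

lemma grv_index_fun_eq:
  assumes h: "cocycle h" and h': "\<And>v j. ((\<lambda>u. h u $ j) has_real_derivative (c v* A v) $ j) (at v)"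
    and deriv: "\<And>v i j. ((\<lambda>u. A u $ i $ j) has_real_derivative (A v ** B) $ i $ j) (at v)"
    and x: "x > 0"
  shows "grv_index_fun B c x = h (ln x)"
proof -
  define f where "f y = (1 / y) *\<^sub>R A (ln y)" for y
  have f_cont: "isCont f y" if "y > 0" for y
  proof -
    have "isCont A (ln y)"
      unfolding isCont_def by (intro vec_tendstoI) (use DERIV_isCont[OF deriv] in \<open>auto simp: isCont_def\<close>)
    then show ?thesis
      unfolding f_def using that by (intro continuous_intros isCont_o2[OF isCont_ln]) auto
  qed
  \<comment> \<open>For x < 1 the oriented integral runs over (x, 1), so \<open>min 1 x\<close> is
    the lower end in either case.\<close>
  have pos: "y > 0" if "min 1 x \<le> y" for y using that x by auto
  have f_int: "interval_lebesgue_integrable lborel (ereal 1) (ereal x) f"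
    using interval_integrable_isCont[of 1 x f] f_cont pos by simp
  have "(LBINT y=ereal 1..ereal x. (1 / y) *\<^sub>R mat_powr y B) = (LBINT y=ereal 1..ereal x. f y)"
    by (simp add: f_def mat_powr_def mat_exp_generator[OF deriv])
  moreover have "(c v* (LBINT y=ereal 1..ereal x. f y)) $ j = h (ln x) $ j" for j
  proof -
    \<comment> \<open>The integrand is matrix valued. T is linear and commutes with the integral,
      which reduces the claim to a real integral for each component.\<close>
    define T :: "real ^ 'n::{finite,wellorder} ^ 'n::{finite,wellorder} \<Rightarrow> real" where "T M = (c v* M) $ j" for M
    have T: "bounded_linear T"
    proof (intro linear_conv_bounded_linear[THEN iffD1] linearI)
      show "T (M + N) = T M + T N" for M N
        by (simp add: T_def vector_matrix_mult_component algebra_simps sum.distrib)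
      show "T (r *\<^sub>R M) = r *\<^sub>R T M" for r M
        by (simp add: T_def vector_matrix_mult_component sum_distrib_left algebra_simps)
    qed
    interpret T: bounded_linear T by (rule T)
    have T_int: "integral\<^sup>L lborel (\<lambda>x. indicator X x * T (f x)) = T (integral\<^sup>L lborel (\<lambda>x. indicator X x *\<^sub>R f x))"
      if "integrable lborel (\<lambda>x. indicator X x *\<^sub>R f x)" for X
      using integral_bounded_linear[OF T that] by (simp add: T.scaleR)
    have "T (LBINT y=ereal 1..ereal x. f y) = (LBINT y=ereal 1..ereal x. T (f y))"
      using f_int by (auto simp: interval_lebesgue_integral_def interval_lebesgue_integrable_def
          set_lebesgue_integral_def set_integrable_def T_int T.neg split: if_splits)
    also have "\<dots> = h (ln x) $ j - h (ln 1) $ j"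
    proof (rule interval_integral_FTC_finite)
      show "continuous_on {min 1 x..max 1 x} (\<lambda>y. T (f y))"
        by (intro continuous_at_imp_continuous_on ballI T.isCont f_cont pos) auto
      fix y assume "min 1 x \<le> y"
      then have "y > 0" by (rule pos)
      have "((\<lambda>y. h (ln y) $ j) has_real_derivative (c v* A (ln y)) $ j * (1 / y)) (at y)"
        by (rule DERIV_chain2[where f = "\<lambda>u. h u $ j" and g = ln, OF h' DERIV_ln_divide[OF \<open>y > 0\<close>]])
      moreover have "(c v* A (ln y)) $ j * (1 / y) = T (f y)"
        by (simp add: T.scaleR f_def) (simp add: T_def)
      ultimately show "((\<lambda>y. h (ln y) $ j) has_vector_derivative T (f y)) (at y within {min 1 x..max 1 x})"
        by (simp add: has_real_derivative_iff_has_vector_derivative has_vector_derivative_at_within)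
    qed
    finally show ?thesis by (simp add: T_def cocycle_zero[OF h])
  qed
  ultimately have "grv_index_fun B c x $ j = h (ln x) $ j" for j
    by (simp add: grv_index_fun_def)
  then show ?thesis by (simp add: vec_eq_iff)
qed

text \<open>The function r u = c A(u) v solves r' = l r, because A(u) B v = l A(u) v, and it
  vanishes at 0, hence everywhere. It is also the derivative of \<open>h u \<bullet> v\<close>,
  which vanishes at 0.\<close>

lemma cocycle_orthogonal_eigenvector:
  assumes h: "cocycle h" and h': "\<And>v j. ((\<lambda>u. h u $ j) has_real_derivative (c v* A v) $ j) (at v)"
    and deriv: "\<And>v i j. ((\<lambda>u. A u $ i $ j) has_real_derivative (A v ** B) $ i $ j) (at v)"
    and v: "B *v v = l *\<^sub>R v" "c \<bullet> v = 0"
  shows "h u \<bullet> v = 0"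
proof -
  define r where "r u = c \<bullet> (A u *v v)" for u
  have r_deriv: "(r has_real_derivative l * r u) (at u)" for u
  proof -
    have "(r has_real_derivative (\<Sum>i\<in>UNIV. c $ i * (\<Sum>j\<in>UNIV. (A u ** B) $ i $ j * v $ j))) (at u)"
      unfolding r_def inner_vec_def matrix_vector_mult_def
      by (auto intro!: derivative_eq_intros deriv simp: mult.commute)
    also have "(\<Sum>i\<in>UNIV. c $ i * (\<Sum>j\<in>UNIV. (A u ** B) $ i $ j * v $ j)) = c \<bullet> ((A u ** B) *v v)"
      by (simp add: inner_vec_def matrix_vector_mult_def)
    also have "\<dots> = l * r u"
      by (simp add: r_def v matrix_vector_mult_scaleR flip: matrix_vector_mul_assoc)
    finally show ?thesis .
  qed
  have "exp (- l * u) * r u = exp (- l * 0) * r 0" for u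
    by (rule DERIV_isconst_all[of "\<lambda>u. exp (- l * u) * r u"]) (auto intro!: derivative_eq_intros r_deriv)
  then have r0: "r u = 0" for u by (simp add: r_def A_zero v)
  have "h u \<bullet> v = h 0 \<bullet> v"
  proof (rule DERIV_isconst_all[of "\<lambda>u. h u \<bullet> v"], rule allI)
    fix u
    have "((\<lambda>u. h u \<bullet> v) has_real_derivative (\<Sum>j\<in>UNIV. (c v* A u) $ j * v $ j)) (at u)"
      unfolding inner_vec_def by (auto intro!: derivative_eq_intros h')
    also have "(\<Sum>j\<in>UNIV. (c v* A u) $ j * v $ j) = (c v* A u) \<bullet> v"
      by (simp add: inner_vec_def)
    also have "\<dots> = r u"
      by (simp add: r_def dot_lmul_matrix)
    finally show "((\<lambda>u. h u \<bullet> v) has_real_derivative 0) (at u)" by (simp add: r0)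
  qed
  then show ?thesis by (simp add: cocycle_zero[OF h])
qed

end

text \<open>The functional given by c is injective on the eigenspace, so the eigenspace is at most
  one-dimensional.\<close>

lemma geometric_multiplicity_eq_one:
  assumes "is_eigenvalue B l" and inj: "\<And>v. B *v v = l *\<^sub>R v \<Longrightarrow> c \<bullet> v = 0 \<Longrightarrow> v = 0"
  shows "geometric_multiplicity B l = 1"
proof -
  obtain w where w: "w \<noteq> 0" "B *v w = l *\<^sub>R w" using assms(1) by (auto simp: is_eigenvalue_def)
  then have cw: "c \<bullet> w \<noteq> 0" using inj by blast
  have "{v. B *v v = l *\<^sub>R v} = span {w}"
  proof (intro equalityI subsetI)
    fix v assume "v \<in> {v. B *v v = l *\<^sub>R v}"
    then have "v - ((c \<bullet> v) / (c \<bullet> w)) *\<^sub>R w = 0"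
      using w cw by (intro inj) (auto simp: algebra_simps matrix_vector_mult_scaleR inner_diff_right)
    then show "v \<in> span {w}" by (auto simp: span_singleton)
  next
    fix v assume "v \<in> span {w}"
    then show "v \<in> {v. B *v v = l *\<^sub>R v}"
      using w by (auto simp: span_singleton matrix_vector_mult_scaleR)
  qed
  then show ?thesis using w(1) by (simp add: geometric_multiplicity_def)
qed

section \<open>Passage to logarithms and the main theorem\<close>

lemma smallo_exp_iff:
  fixes f g :: "real \<Rightarrow> real"
  shows "(\<lambda>s. f (exp s)) \<in> o[at_top](\<lambda>s. g (exp s)) \<longleftrightarrow> f \<in> o[at_top](g)"
proof
  assume "(\<lambda>s. f (exp s)) \<in> o[at_top](\<lambda>s. g (exp s))"
  then have "(\<lambda>t. f (exp (ln t))) \<in> o[at_top](\<lambda>t. g (exp (ln t)))"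
    by (rule landau_o.small.compose) (rule ln_at_top)
  moreover have eq: "\<forall>\<^sub>F t in at_top. k (exp (ln t)) = k t" for k :: "real \<Rightarrow> real"
    using eventually_gt_at_top[of 0] by eventually_elim simp
  ultimately show "f \<in> o[at_top](g)"
    by (simp only: landau_o.small.cong_ex[OF eq eq])
next
  assume "f \<in> o[at_top](g)"
  then show "(\<lambda>s. f (exp s)) \<in> o[at_top](\<lambda>s. g (exp s))"
    by (rule landau_o.small.compose) (rule exp_at_top)
qed

text \<open>Continuity handles only preimages of Borel sets. The preimage of a Lebesgue set is an
  image under ln, and differentiable maps of the line preserve Lebesgue measurability.\<close>

lemma measurable_exp_lebesgue: "(exp :: real \<Rightarrow> real) \<in> lebesgue \<rightarrow>\<^sub>M lebesgue"
proof (rule measurableI)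
  fix X :: "real set" assume X: "X \<in> sets lebesgue"
  have "exp -` X = ln ` (X \<inter> {0<..})"
    by (force simp: image_iff)
  also have "\<dots> \<in> sets lebesgue"
  proof (rule differentiable_image_in_sets_lebesgue)
    show "X \<inter> {0<..} \<in> sets lebesgue" using X by auto
    show "(ln :: real \<Rightarrow> real) differentiable_on X \<inter> {0<..}"
      unfolding differentiable_on_def
      by (auto simp: real_differentiable_def intro: has_field_derivative_at_within[OF DERIV_ln])
  qed simp
  finally show "exp -` X \<inter> space lebesgue \<in> sets lebesgue" by simp
qed simp

lemma measurable_exp_shift_lebesgue: "(\<lambda>u::real. exp (t + u)) \<in> lebesgue \<rightarrow>\<^sub>M lebesgue"
  using measurable_compose[OF measurable_exp_lebesgue lebesgue_measurable_scaling[of "exp t"]]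
  by (simp add: exp_add)

text \<open>Outside D nothing is known about f, so it is replaced by 0 there. For fixed u this
  changes nothing for large t when D is a neighbourhood of infinity.\<close>

lemma borel_measurable_exp_shift:
  fixes f :: "real \<Rightarrow> real"
  assumes "D \<in> sets lebesgue" and "f \<in> borel_measurable (lebesgue_on D)"
  shows "(\<lambda>u. if exp (t + u) \<in> D then f (exp (t + u)) else 0) \<in> borel_measurable lebesgue"
  using measurable_compose[OF measurable_exp_shift_lebesgue, of "\<lambda>x. if x \<in> D then f x else 0" borel t]
    assms by (simp add: borel_measurable_if)

text \<open>\<open>rate_vector\<close> compares neighbouring indices only; transitivity bridges the
  gap, by induction on the number of indices in between.\<close>

lemma rate_vector_less:
  fixes g :: "real \<Rightarrow> real ^ 'n::{finite,wellorder}"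
  assumes "rate_vector E g" and "i < j"
  shows "(\<lambda>t. g t $ j) \<in> o[at_top](\<lambda>t. g t $ i)"
  using \<open>i < j\<close>
proof (induction "card {i<..<j}" arbitrary: i j rule: less_induct)
  case less
  show ?case
  proof (cases "{i<..<j} = {}")
    case True
    then show ?thesis using assms(1) less.prems by (simp add: rate_vector_def)
  next
    case False
    then obtain k where k: "i < k" "k < j" by auto
    have "card {i<..<k} < card {i<..<j}" "card {k<..<j} < card {i<..<j}"
      using k by (auto intro!: psubset_card_mono)
    then show ?thesis
      using less.hyps[of i k] less.hyps[of k j] k by (blast intro: landau_o.small_trans)
  qed
qed

lemma ln_image_non_negligible:
  fixes K :: "real set"
  assumes "K \<subseteq> {0<..}" and "\<not> negligible K"
  shows "\<not> negligible (ln ` K)"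
proof
  assume "negligible (ln ` K)"
  then have "negligible (exp ` ln ` K)"
    by (rule negligible_differentiable_image_negligible[OF order_refl])
      (auto simp: differentiable_on_def real_differentiable_def intro: has_field_derivative_at_within[OF DERIV_exp])
  moreover have "exp ` ln ` K = K"
    using assms(1) by (force simp: image_iff)
  ultimately show False using assms(2) by simp
qed

theorem theorem3p9:
  fixes f :: "real \<Rightarrow> real" and D :: "real set"
    and g :: "real \<Rightarrow> real ^ 'n::{finite,wellorder}" and E :: "real set"
    and xs :: "'n \<Rightarrow> real"
  assumes f_dom: "nbhd_of_infinity D" and f_meas: "measurable_fun_on D f"
    and g_rate: "rate_vector E g" and g_meas: "measurable_fun_on E g"
    and xs_T: "\<forall>i. xs i \<in> expansion_set f g"
    and inv: "invertible (\<chi> i. expansion_coeff f g (xs i))"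
    and pos_meas: "\<exists>S \<in> sets lebesgue. emeasure lebesgue S > 0 \<and>
        S \<subseteq> {y \<in> expansion_set f g. \<forall>i. xs i * y \<in> expansion_set f g}"
    and below: "{y \<in> expansion_set f g. \<forall>i. xs i * y \<in> expansion_set f g} \<inter> {0<..<1} \<noteq> {}"
    and above: "{y \<in> expansion_set f g. \<forall>i. xs i * y \<in> expansion_set f g} \<inter> {1<..} \<noteq> {}"
  shows "(\<forall>x \<in> expansion_set f g. \<exists>!a. has_expansion f g x a) \<and>
    (\<exists>B c. index_matrix B \<and> regularly_varying E g B \<and>
       generalised_regularly_varying D f E g B c \<and>
       (\<forall>x>0. expansion_coeff f g x = grv_index_fun B c x) \<and>
       (\<forall>l. is_eigenvalue B l \<longrightarrow> geometric_multiplicity B l = 1))"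
proof -
  define G where "G s = g (exp s)" for s
  define F where "F s = f (exp s)" for s
  interpret additive_rate G
  proof
    fix i j :: 'n
    have "eventually_constant_sign (\<lambda>t. g t $ i)" using g_rate by (simp add: rate_vector_def)
    then have "\<forall>\<^sub>F t in at_top. g t $ i \<noteq> 0"
      unfolding eventually_constant_sign_def by (auto elim: eventually_mono)
    then show "\<forall>\<^sub>F s in at_top. G s $ i \<noteq> 0"
      unfolding G_def by (rule eventually_compose_filterlim[OF _ exp_at_top])
    show "(\<lambda>s. G s $ j) \<in> o[at_top](\<lambda>s. G s $ i)" if "i < j"
      using rate_vector_less[OF g_rate that] unfolding G_def
      by (rule landau_o.small.compose) (rule exp_at_top)
  qed
  have expansion_iff: "has_expansion f g (exp y) a \<longleftrightarrow> increment F y a" for y a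
    unfolding has_expansion_def increment_def F_def G_def exp_add
    by (rule smallo_exp_iff[where f = "\<lambda>t. f (t * exp y) - f t - a \<bullet> g t", symmetric])
  have expansion_ln: "has_expansion f g x a \<longleftrightarrow> increment F (ln x) a" if "x > 0" for x a
    using expansion_iff[of "ln x" a] that by simp
  have coeff: "expansion_coeff f g x = a" if "x > 0" "increment F (ln x) a" for x a
    unfolding expansion_coeff_def using that increment_unique by (auto simp: expansion_ln)
  have unique: "\<forall>x \<in> expansion_set f g. \<exists>!a. has_expansion f g x a"
    using increment_unique by (auto simp: expansion_set_def expansion_ln)

  define H where "H = (\<chi> i. expansion_coeff f g (xs i))"
  have xs_pos: "xs i > 0" for i using xs_T by (simp add: expansion_set_def)
  have H: "increment F (ln (xs i)) (H $ i)" for i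
  proof -
    obtain a where "increment F (ln (xs i)) a"
      using xs_T expansion_ln[OF xs_pos[of i]] unfolding expansion_set_def by blast
    then show ?thesis using coeff[OF xs_pos] by (simp add: H_def)
  qed
  \<comment> \<open>Both conditions are kept together: \<open>increment_add\<close> composes
    increments only with the help of a shift matrix.\<close>
  define P where "P = {s. \<exists>M a. shift_matrix s M \<and> increment F s a}"
  have ln_P: "ln y \<in> P" if y_T: "y \<in> expansion_set f g" and xy_T: "\<forall>i. xs i * y \<in> expansion_set f g" for y
  proof -
    have y: "y > 0" using y_T by (simp add: expansion_set_def)
    obtain b where b: "increment F (ln y) b"
      using y_T expansion_ln[OF y] unfolding expansion_set_def by blast
    have "\<forall>i. \<exists>a. increment F (ln (xs i) + ln y) a"
    proof
      fix i
      obtain a where "has_expansion f g (xs i * y) a"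
        using xy_T unfolding expansion_set_def by blast
      then have "increment F (ln (xs i) + ln y) a"
        using expansion_ln[of "xs i * y" a] xs_pos[of i] y by (simp add: ln_mult_pos)
      then show "\<exists>a. increment F (ln (xs i) + ln y) a" ..
    qed
    then obtain C where C: "\<And>i. increment F (ln (xs i) + ln y) (C i)" by metis
    have "\<exists>M. shift_matrix (ln y) M"
      using shift_matrix_exists[of F "\<lambda>i. ln (xs i)" H "ln y" b "\<chi> i. C i"] H C b inv
      by (simp add: H_def)
    with b show ?thesis by (auto simp: P_def)
  qed
  have "P = UNIV"
  proof -
    obtain S where S: "S \<in> sets lebesgue" "emeasure lebesgue S > 0"
      "S \<subseteq> {y \<in> expansion_set f g. \<forall>i. xs i * y \<in> expansion_set f g}"
      using pos_meas by blast
    then have "\<not> negligible S" by (auto simp: negligible_iff_null_sets null_sets_def)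
    \<comment> \<open>For compact K inside the positive reals the image under ln is compact, hence
      measurable.\<close>
    from compact_inner_non_negligible[OF S(1) this] obtain K
      where K: "compact K" "K \<subseteq> S" "\<not> negligible K" .
    have K_pos: "K \<subseteq> {0<..}" using K(2) S(3) by (auto simp: expansion_set_def)
    have ln_K: "compact (ln ` K)"
      using K(1) K_pos by (intro compact_continuous_image continuous_on_ln continuous_on_id) auto
    obtain p where p: "p \<in> expansion_set f g" "\<forall>i. xs i * p \<in> expansion_set f g" "p > 1"
      using above by auto
    obtain q where q: "q \<in> expansion_set f g" "\<forall>i. xs i * q \<in> expansion_set f g" "0 < q" "q < 1"
      using below by auto
    show ?thesis
    proof (rule real_subsemigroup_eq_UNIV)
      show "s + r \<in> P" if "s \<in> P" "r \<in> P" for s r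
        using that shift_matrix_add increment_add unfolding P_def by blast
      show "ln ` K \<in> sets lebesgue" using ln_K lmeasurable_compact by blast
      show "\<not> negligible (ln ` K)" using K_pos K(3) by (rule ln_image_non_negligible)
      show "ln ` K \<subseteq> P" using K(2) S(3) ln_P by auto
      show "ln p \<in> P" "ln q \<in> P" using p q ln_P by auto
      show "ln p > 0" "ln q < 0" using p q by auto
    qed
  qed
  then have "\<forall>s. \<exists>M. shift_matrix s M" "\<forall>s. \<exists>a. increment F s a" by (auto simp: P_def)
  then obtain A h where A: "\<And>s. shift_matrix s (A s)" and h: "\<And>s. increment F s (h s)" by metis

  obtain t0 where t0: "{t0..} \<subseteq> D" using f_dom by (auto simp: nbhd_of_infinity_def)
  obtain t1 where t1: "{t1..} \<subseteq> E" using g_rate by (auto simp: rate_vector_def nbhd_of_infinity_def)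
  have large: "\<forall>\<^sub>F t in at_top. exp (t + u) \<in> X" if "{r..} \<subseteq> X" for r u :: real and X
  proof -
    have "filterlim (\<lambda>t. exp (u + t)) at_top at_top"
      by (intro filterlim_compose[OF exp_at_top] filterlim_tendsto_add_at_top[OF tendsto_const] filterlim_ident)
    then have "\<forall>\<^sub>F t in at_top. exp (u + t) \<ge> r" by (simp add: filterlim_at_top)
    then show ?thesis using that by (auto simp: add.commute elim: eventually_mono)
  qed
  have A_meas: "(\<lambda>u. A u $ i $ j) \<in> borel_measurable lebesgue" for i j
  proof (rule coeff_measurable)
    have "(\<lambda>t. g t $ i) \<in> borel_measurable (lebesgue_on E)"
      using g_meas unfolding measurable_fun_on_def
      by (intro measurable_compose[OF _ borel_measurable_nth]) blast
    \<comment> \<open>The function cut off outside E is measurable in u for every t, and for every u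
      it agrees with the original for large t, so it has the same coefficients.\<close>
    then show "(\<lambda>u. if exp (t + u) \<in> E then g (exp (t + u)) $ i else 0) \<in> borel_measurable lebesgue" for t
      using g_meas by (intro borel_measurable_exp_shift) (simp_all add: measurable_fun_on_def)
    fix u
    have "(\<lambda>t. G (t + u) $ i - A u $ i \<bullet> G t) \<in> o[at_top](\<lambda>t. G t $ last_index)"
      using A[of u] by (simp add: shift_matrix_def)
    then show "(\<lambda>t. (if exp (t + u) \<in> E then g (exp (t + u)) $ i else 0) - A u $ i \<bullet> G t)
        \<in> o[at_top](\<lambda>t. G t $ last_index)"
      by (rule landau_o.small.in_cong[THEN iffD1, rotated])
        (use large[OF t1, of u] in \<open>auto simp: G_def elim: eventually_mono\<close>)
  qed
  have h_meas: "(\<lambda>u. h u $ j) \<in> borel_measurable lebesgue" for j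
  proof (rule coeff_measurable)
    \<comment> \<open>The term \<open>F t\<close> is constant in u and hence measurable, even where
      \<open>exp t\<close> is outside D.\<close>
    show "(\<lambda>u. (if exp (t + u) \<in> D then f (exp (t + u)) else 0) - F t) \<in> borel_measurable lebesgue" for t
      using f_meas by (intro borel_measurable_diff borel_measurable_exp_shift borel_measurable_const)
        (simp_all add: measurable_fun_on_def)
    fix u
    have "(\<lambda>t. F (t + u) - F t - h u \<bullet> G t) \<in> o[at_top](\<lambda>t. G t $ last_index)"
      using h[of u] by (simp add: increment_def)
    then show "(\<lambda>t. (if exp (t + u) \<in> D then f (exp (t + u)) else 0) - F t - h u \<bullet> G t)
        \<in> o[at_top](\<lambda>t. G t $ last_index)"
      by (rule landau_o.small.in_cong[THEN iffD1, rotated])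
        (use large[OF t0, of u] in \<open>auto simp: F_def elim: eventually_mono\<close>)
  qed
  interpret A: one_parameter_group A
  proof
    show "A 0 = mat 1" by (rule shift_matrix_unique[OF A shift_matrix_zero])
    show "A (u + v) = A u ** A v" for u v by (rule shift_matrix_unique[OF A shift_matrix_add[OF A A]])
    show "A u $ i $ j = 0" if "j < i" for u i j by (rule shift_matrix_upper_triangular[OF A that])
  qed (rule A_meas)
  have cocycle: "A.cocycle h"
    unfolding A.cocycle_def using h_meas increment_unique[OF h increment_add[OF h h A]] by blast
  obtain B where left: "\<And>v i j. ((\<lambda>u. A u $ i $ j) has_real_derivative (B ** A v) $ i $ j) (at v)"
    and right: "\<And>v i j. ((\<lambda>u. A u $ i $ j) has_real_derivative (A v ** B) $ i $ j) (at v)"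
    using A.generator_exists by blast
  have deriv0: "((\<lambda>u. A u $ i $ j) has_real_derivative B $ i $ j) (at 0)" for i j
    using right[of i j 0] by (simp add: A.A_zero)
  obtain c where c: "\<And>v j. ((\<lambda>u. h u $ j) has_real_derivative (c v* A v) $ j) (at v)"
    using A.cocycle_has_derivative[OF cocycle] by blast
  have grv: "grv_index_fun B c x = h (ln x)" if "x > 0" for x
    by (rule A.grv_index_fun_eq[OF cocycle c right that])
  have mult: "geometric_multiplicity B l = 1" if "is_eigenvalue B l" for l
  proof (rule geometric_multiplicity_eq_one[OF that])
    fix v assume v: "B *v v = l *\<^sub>R v" "c \<bullet> v = 0"
    have "H $ i = h (ln (xs i))" for i by (rule increment_unique[OF H h])
    then have "(H *v v) $ i = 0" for i
      using A.cocycle_orthogonal_eigenvector[OF cocycle c right v]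
      by (simp add: matrix_vector_mul_component)
    then have "H *v v = 0" by (simp add: vec_eq_iff)
    moreover obtain K where "K ** H = mat 1" using inv unfolding H_def invertible_def by auto
    ultimately show "v = 0"
      by (metis matrix_vector_mul_assoc matrix_vector_mul_lid matrix_vector_mult_0_right)
  qed
  have index: "index_matrix B"
    unfolding index_matrix_def
  proof (intro conjI allI impI)
    show "B $ i $ j = 0" if "j < i" for i j
      by (rule A.generator_upper_triangular[OF deriv0 that])
    show "B $ j $ j \<le> B $ i $ i" if "i \<le> j" for i j
    proof (cases "i = j")
      case False
      with that show ?thesis
        by (intro A.generator_diag_mono[OF deriv0] shift_diagonal_mono[OF A] A.A_diag_pos) auto
    qed simp
  qed (use mult in blast)
  have reg: "regularly_varying E g B"
    unfolding regularly_varying_def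
  proof (intro conjI allI impI g_rate g_meas index)
    fix x :: real and i assume "x > 0"
    then have "mat_powr x B = A (ln x)"
      by (simp add: mat_powr_def A.mat_exp_generator[OF right])
    moreover have "(\<lambda>s. g (x * exp s) $ i - A (ln x) $ i \<bullet> g (exp s)) \<in> o[at_top](\<lambda>s. g (exp s) $ last_index)"
      using A[of "ln x"] \<open>x > 0\<close> by (simp add: shift_matrix_def G_def exp_add mult.commute)
    ultimately show "(\<lambda>t. (g (x * t) - mat_powr x B *v g t) $ i) \<in> o[at_top](\<lambda>t. g t $ last_index)"
      by (subst smallo_exp_iff[symmetric]) (simp add: matrix_vector_mul_component)
  qed
  have "generalised_regularly_varying D f E g B c"
    unfolding generalised_regularly_varying_def
    using reg f_dom f_meas h by (auto simp: expansion_ln grv)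
  moreover have "\<forall>x>0. expansion_coeff f g x = grv_index_fun B c x"
    using h coeff by (auto simp: grv)
  ultimately show ?thesis using unique index reg mult by blast
qed

end
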